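(* Let $\mathcal{H}$ be a finite-dimensional real Hilbert space, $n\geq1$ an integer and $L>0$. Let $A_1,\dots,A_n\colon\mathcal{H}\rightrightarrows\mathcal{H}$ be maximally monotone operators and let $B_1,\dots,B_n\colon\mathcal{H}\to\mathcal{H}$ be monotone and $L$-Lipschitz continuous. Suppose the inclusion $$0\in\sum_{i=1}^n(A_i+B_i)(x)\subset\mathcal{H}\qquad (I)$$ has at least one solution. Let $W\in\mathbb{R}^{n\times n}$ be a mixing matrix and let $\tau\in\bigl(0,\frac{1+\lambda_{\min}(W)}{4L}\bigr)$. Let $\mathbf{x}^0=\mathbf{x}^{-1}\in\mathcal{H}^n$ be arbitrary, and define $$\mathbf{v}^0=\mathbf{B}(\mathbf{x}^0),\qquad \mathbf{u}^1=\mathbf{x}^0-\tau\mathbf{v}^0,\qquad \mathbf{x}^1=J_{\tau\mathbf{A}}(\mathbf{u}^1),$$ and, for $k=1,2,\dots$, $$\begin{aligned} \mathbf{v}^k&=2\mathbf{B}(\mathbf{x}^k)-\mathbf{B}(\mathbf{x}^{k-1}),\\ \mathbf{u}^{k+1}&=W\mathbf{x}^k+\mathbf{u}^k-\tfrac12(\mathrm{Id}+W)\mathbf{x}^{k-1}-\tau(\mathbf{v}^k-\mathbf{v}^{k-1}),\\ \mathbf{x}^{k+1}&=J_{\tau\mathbf{A}}(\mathbf{u}^{k+1}). \end{aligned}$$ Then the sequence $(\mathbf{x}^k)$ converges to a point $\mathbf{x}=(x,\dots,x)\in\mathcal{H}^n$ such that $x$ is a solution of $(I)$.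
   Context: $\mathcal{H}^n=\{(x_1,\dots,x_n):x_i\in\mathcal{H}\}$ with the product Hilbert space structure. A matrix $W=(w_{ij})\in\mathbb{R}^{n\times n}$ acts on $\mathcal{H}^n$ by $(W\mathbf{x})_i=\sum_{j=1}^nw_{ij}x_j$. For $\mathbf{x}=(x_1,\dots,x_n)\in\mathcal{H}^n$: $\mathbf{A}(\mathbf{x})=A_1(x_1)\times\dots\times A_n(x_n)$ and $\mathbf{B}(\mathbf{x})=(B_1(x_1),\dots,B_n(x_n))$. A set-valued operator $A$ is monotone if $\langle x-u,y-v\rangle\geq0$ for all $y\in A(x)$, $v\in A(u)$, and maximally monotone if no monotone operator properly extends it. The resolvent is $J_A=(\mathrm{Id}+A)^{-1}$, single-valued with full domain when $A$ is maximally monotone. Mixing matrix: given a simple undirected connected graph with vertex set $\{1,\dots,n\}$ and edge set $\mathcal{E}$, a matrix $W=(w_{ij})\in\mathbb{R}^{n\times n}$ is a mixing matrix if (a) $w_{ij}=0$ whenever $i\neq j$ and $(i,j)\notin\mathcal{E}$; (b) $W=W^\top$; (c) $\ker(\mathrm{Id}-W)=\{x\in\mathbb{R}^n: x_1=\dots=x_n\}$; (d) $\mathrm{Id}\succeq W\succ-\mathrm{Id}$, i.e. $\mathrm{Id}-W$ is positive semidefinite and $W+\mathrm{Id}$ is positive definite. $\lambda_{\min}(W)$ denotes the smallest eigenvalue of $W$. *)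

theory Defs
  imports "HOL-Analysis.Analysis"
begin

text \<open>
  Set-valued operators are functions into sets; sums of sets are Minkowski sums, as
  provided by the library's arithmetic on sets.
\<close>

definition monotone_operator :: "('a::real_inner \<Rightarrow> 'a set) \<Rightarrow> bool" where
  "monotone_operator A \<longleftrightarrow>
     (\<forall>x u. \<forall>y\<in>A x. \<forall>v\<in>A u. inner (x - u) (y - v) \<ge> 0)"

definition maximally_monotone :: "('a::real_inner \<Rightarrow> 'a set) \<Rightarrow> bool" where
  "maximally_monotone A \<longleftrightarrow>
     monotone_operator A \<and>
     (\<forall>A'. monotone_operator A' \<and> (\<forall>x. A x \<subseteq> A' x) \<longrightarrow> A' = A)"

definition scale_operator :: "real \<Rightarrow> ('a::real_vector \<Rightarrow> 'a set) \<Rightarrow> 'a \<Rightarrow> 'a set" where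
  "scale_operator t A x = (\<lambda>y. t *\<^sub>R y) ` A x"

definition inverse_operator :: "('a \<Rightarrow> 'b set) \<Rightarrow> 'b \<Rightarrow> 'a set" where
  "inverse_operator A y = {x. y \<in> A x}"

text \<open>
  The inverse of \<open>Id + A\<close>, with its singleton values identified with their elements.
  The result is unspecified wherever the set-valued inverse is not a singleton, which does
  not happen for maximally monotone \<open>A\<close> on a Hilbert space (Minty's theorem).
\<close>
definition resolvent :: "('a::real_vector \<Rightarrow> 'a set) \<Rightarrow> 'a \<Rightarrow> 'a" where
  "resolvent A u = the_elem (inverse_operator (\<lambda>x. {x} + A x) u)"

definition prod_operator :: "('n \<Rightarrow> 'a \<Rightarrow> 'a set) \<Rightarrow> 'a ^ 'n \<Rightarrow> ('a ^ 'n) set" where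
  "prod_operator A x = {y. \<forall>i. y $ i \<in> A i (x $ i)}"

definition prod_map :: "('n \<Rightarrow> 'a \<Rightarrow> 'a) \<Rightarrow> 'a ^ 'n \<Rightarrow> 'a ^ 'n" where
  "prod_map B x = (\<chi> i. B i (x $ i))"

definition mat_act :: "real ^ 'n ^ 'n \<Rightarrow> ('a::real_vector) ^ 'n \<Rightarrow> 'a ^ 'n" where
  "mat_act W x = (\<chi> i. \<Sum>j\<in>UNIV. W $ i $ j *\<^sub>R x $ j)"

text \<open>
  A simple undirected graph on all of \<open>'n\<close>; each edge is recorded in both
  orientations.
\<close>
definition connected_simple_graph :: "('n \<times> 'n) set \<Rightarrow> bool" where
  "connected_simple_graph E \<longleftrightarrow> sym E \<and> irrefl E \<and> (\<forall>i j. (i, j) \<in> E\<^sup>*)"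

definition mixing_matrix :: "('n \<times> 'n) set \<Rightarrow> real ^ 'n ^ 'n \<Rightarrow> bool" where
  "mixing_matrix E W \<longleftrightarrow>
     (\<forall>i j. i \<noteq> j \<and> (i, j) \<notin> E \<longrightarrow> W $ i $ j = 0) \<and>
     W = transpose W \<and>
     {x. (mat 1 - W) *v x = 0} = {x. \<forall>i j. x $ i = x $ j} \<and>
     (\<forall>x. inner x ((mat 1 - W) *v x) \<ge> 0) \<and>
     (\<forall>x. x \<noteq> 0 \<longrightarrow> inner x ((W + mat 1) *v x) > 0)"

text \<open>
  Meaningful for symmetric \<open>W\<close>, whose set of real eigenvalues is finite and nonempty.
\<close>
definition lambda_min :: "real ^ 'n ^ 'n \<Rightarrow> real" where
  "lambda_min W = Min {l. \<exists>x. x \<noteq> 0 \<and> W *v x = l *\<^sub>R x}"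

definition is_solution ::
    "('n::finite \<Rightarrow> 'a \<Rightarrow> 'a set) \<Rightarrow> ('n \<Rightarrow> 'a \<Rightarrow> 'a::real_vector) \<Rightarrow> 'a \<Rightarrow> bool" where
  "is_solution A B x \<longleftrightarrow> 0 \<in> (\<Sum>i\<in>UNIV. A i x + {B i x})"

end

theory Submission
  imports Defs
begin

text \<open>
  Put \<open>M = (I - W) / 2\<close>. By the kernel condition on \<open>W\<close>, the consensus points
  \<open>(z, \<dots>, z)\<close> are the kernel of \<open>M\<close>, and since \<open>M\<close> is symmetric its range is the set of
  vectors whose components sum to zero. Hence \<open>z\<close> solves the inclusion iff, with
  \<open>p = (z, \<dots>, z)\<close>, some dual vector \<open>q\<close> satisfies
  \<open>- \<tau> \<bold>B p - M q \<in> \<tau> \<bold>A p\<close>: the pairs \<open>(p, q)\<close> with this property and \<open>M p = 0\<close> are the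
  saddle points of a primal-dual inclusion.

  Summing the recursion for \<open>\<bold>u\<close> exhibits the algorithm as a primal-dual iteration. With the
  dual sequence \<open>y\<^sub>0 = - x\<^sub>0\<close>, \<open>y\<^sub>k\<^sub>+\<^sub>1 = y\<^sub>k + x\<^sub>k\<^sub>+\<^sub>1\<close> one gets
  \<open>u\<^sub>k\<^sub>+\<^sub>1 = x\<^sub>k - \<tau> v\<^sub>k - M (y\<^sub>k + x\<^sub>k)\<close>, and the resolvent turns this into
  \<open>u\<^sub>k\<^sub>+\<^sub>1 - x\<^sub>k\<^sub>+\<^sub>1 \<in> \<tau> \<bold>A x\<^sub>k\<^sub>+\<^sub>1\<close>. Comparing with a saddle point by monotonicity of \<open>\<bold>A\<close> and
  \<open>\<bold>B\<close> gives a Lyapunov function that decreases by at least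
  \<open>(\<mu> - 2 \<tau> L) |x\<^sub>k\<^sub>+\<^sub>1 - x\<^sub>k|\<^sup>2 + \<langle>x\<^sub>k, M x\<^sub>k\<rangle>\<close> in each step (\<open>energy_decrease\<close>), where
  \<open>\<mu> = (1 + lambda_min W) / 2\<close>; the Rayleigh bound \<open>M \<le> (1 - \<mu>) I\<close> is where the smallest
  eigenvalue enters, and the step size bound says exactly that \<open>2 \<tau> L < \<mu>\<close>. So
  \<open>x\<^sub>k\<^sub>+\<^sub>1 - x\<^sub>k\<close> and \<open>M x\<^sub>k\<close> vanish in the limit while \<open>x\<^sub>k\<close> and \<open>M y\<^sub>k\<close> stay bounded.
  A cluster point is a saddle point because maximally monotone operators have closed graphs; the
  Lyapunov function of that saddle point tends to zero along a subsequence, hence along the whole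
  sequence, which forces convergence (\<open>convergence\<close>).

  That the resolvent equation can be used at all is Minty's theorem, proved here in finite
  dimensions (\<open>minty_surjective\<close>): a compactness argument reduces it to finitely many
  points of the graph, for which a solution maximises a concave function on a polytope.
\<close>

section \<open>Finite-dimensional inner product spaces\<close>

text \<open>
  The basis vectors need not be normalised. A zero vector among them does no harm: its coefficient
  is \<open>0 / 0 = 0\<close>.
\<close>

lemma orthogonal_expansion:
  fixes S :: "'a::real_inner set"
  assumes "finite S" "span S = UNIV" "pairwise orthogonal S"
  shows "a = (\<Sum>e\<in>S. (inner a e / inner e e) *\<^sub>R e)"
proof -
  have "a \<in> span S"
    using assms by simp
  then show ?thesis
  proof (induction rule: span_induct_alt)
    case base
    then show ?case by simp
  next
    case (step c b y)
    have "(\<Sum>e\<in>S. (inner b e / inner e e) *\<^sub>R e) = (\<Sum>e\<in>S. if e = b then b else 0)"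
      using assms(3) \<open>b \<in> S\<close>
      by (intro sum.cong) (auto simp: pairwise_def orthogonal_def)
    also have "\<dots> = b"
      using \<open>b \<in> S\<close> \<open>finite S\<close> by simp
    finally have b: "(\<Sum>e\<in>S. (inner b e / inner e e) *\<^sub>R e) = b" .
    have "(\<Sum>e\<in>S. (inner (c *\<^sub>R b + y) e / inner e e) *\<^sub>R e)
        = c *\<^sub>R (\<Sum>e\<in>S. (inner b e / inner e e) *\<^sub>R e) + (\<Sum>e\<in>S. (inner y e / inner e e) *\<^sub>R e)"
      by (simp add: inner_add_left add_divide_distrib scaleR_add_left sum.distrib scaleR_sum_right)
    then show ?case
      using b step by simp
  qed
qed

lemma parseval_inner:
  fixes S :: "'a::real_inner set"
  assumes "finite S" "span S = UNIV" "pairwise orthogonal S"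
  shows "inner a b = (\<Sum>e\<in>S. inner a e * inner b e / inner e e)"
proof -
  have "inner a b = inner (\<Sum>e\<in>S. (inner a e / inner e e) *\<^sub>R e) b"
    using orthogonal_expansion[OF assms, of a] by simp
  also have "\<dots> = (\<Sum>e\<in>S. inner a e * inner b e / inner e e)"
    by (subst inner_sum_left) (simp add: inner_commute[of b])
  finally show ?thesis .
qed

lemma compact_sum_sets:
  fixes K :: "'i \<Rightarrow> 'a::real_normed_vector set"
  assumes "finite I" "\<And>i. i \<in> I \<Longrightarrow> compact (K i)"
  shows "compact (\<Sum>i\<in>I. K i)"
  using assms
proof (induction rule: finite_induct)
  case empty
  then show ?case by (simp add: set_zero)
next
  case (insert i I)
  have "compact {a + b | a b. a \<in> K i \<and> b \<in> (\<Sum>i\<in>I. K i)}"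
    using insert by (intro compact_sums) auto
  moreover have "{a + b | a b. a \<in> K i \<and> b \<in> (\<Sum>i\<in>I. K i)} = K i + (\<Sum>i\<in>I. K i)"
    by (auto simp: set_plus_def)
  ultimately show ?case
    using insert by simp
qed

text \<open>
  Coordinates with respect to an orthogonal basis are bounded on a ball, so the ball is a closed
  subset of a sum of finitely many compact segments. Working with a spanning set instead of the
  class \<open>euclidean_space\<close> makes the result available on any inner product space of
  finite dimension.
\<close>

lemma compact_cball_finite_dimensional:
  fixes a :: "'a::real_inner"
  assumes "\<exists>S :: 'a set. finite S \<and> span S = UNIV"
  shows "compact (cball a r)"
proof -
  obtain S0 :: "'a set" where "finite S0" "span S0 = UNIV"
    using assms by blast
  then obtain S :: "'a set" where S: "finite S" "span S = UNIV" "pairwise orthogonal S"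
    using basis_orthogonal[of S0] by auto
  define K where "K e = (\<lambda>t. t *\<^sub>R e) ` {- ((norm a + r) / norm e)..(norm a + r) / norm e}" for e :: 'a
  have "compact (K e)" for e
    unfolding K_def by (intro compact_continuous_image continuous_intros compact_Icc)
  then have "compact (\<Sum>e\<in>S. K e)"
    using S by (intro compact_sum_sets) auto
  moreover have "cball a r \<subseteq> (\<Sum>e\<in>S. K e)"
  proof
    fix z assume "z \<in> cball a r"
    then have z: "norm z \<le> norm a + r"
      using norm_triangle_ineq[of a "z - a"] by (simp add: dist_norm norm_minus_commute)
    have "(inner z e / inner e e) *\<^sub>R e \<in> K e" for e
    proof -
      have "\<bar>inner z e / inner e e\<bar> \<le> norm z * norm e / (norm e)\<^sup>2"
        using Cauchy_Schwarz_ineq2[of z e] by (simp add: power2_norm_eq_inner divide_right_mono)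
      also have "\<dots> = norm z / norm e"
        by (simp add: power2_eq_square)
      also have "\<dots> \<le> (norm a + r) / norm e"
        using z by (simp add: divide_right_mono)
      finally show ?thesis
        unfolding K_def by (intro imageI) (auto simp only: abs_le_iff atLeastAtMost_iff)
    qed
    then have "(\<Sum>e\<in>S. (inner z e / inner e e) *\<^sub>R e) \<in> (\<Sum>e\<in>S. K e)"
      using S(1) by (auto simp: set_sum_alt)
    then show "z \<in> (\<Sum>e\<in>S. K e)"
      using orthogonal_expansion[OF S, of z] by simp
  qed
  ultimately show ?thesis
    using compact_Int_closed[of "\<Sum>e\<in>S. K e" "cball a r"] by (simp add: Int_absorb1)
qed

lemma bounded_sequence_subsequence:
  fixes f :: "nat \<Rightarrow> 'a::real_inner"
  assumes "\<exists>S :: 'a set. finite S \<and> span S = UNIV" "\<And>k. norm (f k) \<le> r"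
  obtains l s where "strict_mono (s :: nat \<Rightarrow> nat)" "(\<lambda>j. f (s j)) \<longlonglongrightarrow> l"
proof -
  have "\<forall>k. f k \<in> cball 0 r"
    using assms by simp
  then show ?thesis
    using compact_cball_finite_dimensional[OF assms(1), of 0 r] that
    unfolding compact_def o_def by metis
qed

lemma finite_dimensional_vec:
  assumes "\<exists>S :: 'a::real_inner set. finite S \<and> span S = UNIV"
  shows "\<exists>S :: ('a ^ 'n::finite) set. finite S \<and> span S = UNIV"
proof -
  obtain S :: "'a set" where S: "finite S" "span S = UNIV"
    using assms by blast
  let ?S = "\<Union>i\<in>UNIV. axis i ` S :: ('a ^ 'n) set"
  have axis: "axis i a \<in> span ?S" for i :: 'n and a
  proof -
    have "a \<in> span S"
      using S by simp
    then show ?thesis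
    proof (induction rule: span_induct_alt)
      case base
      have "axis i 0 = (0 :: 'a ^ 'n)" by simp
      then show ?case by (simp only: span_zero)
    next
      case (step c b y)
      have "axis i (c *\<^sub>R b + y) = c *\<^sub>R axis i b + axis i y"
        by (auto simp: vec_eq_iff axis_def)
      moreover have "axis i b \<in> span ?S"
        using step by (intro span_base) auto
      ultimately show ?case
        using step by (simp add: span_add span_scale)
    qed
  qed
  have "x \<in> span ?S" for x
  proof -
    have "(\<Sum>i\<in>UNIV. axis i (x $ i)) \<in> span ?S"
      using axis by (intro span_sum)
    moreover have "(\<Sum>i\<in>UNIV. axis i (x $ i)) = x"
      by (simp add: vec_eq_iff axis_def)
    ultimately show ?thesis by simp
  qed
  then have "span ?S = UNIV" by auto
  moreover have "finite ?S" using S by auto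
  ultimately show ?thesis by blast
qed

section \<open>Maximally monotone operators\<close>

text \<open>
  Maximality in the form in which it is used: any pair monotonically related to the whole graph
  already lies in the graph, since it could otherwise be added to it.
\<close>

lemma maximally_monotone_iff:
  "maximally_monotone A \<longleftrightarrow> monotone_operator A \<and>
     (\<forall>x y. (\<forall>u. \<forall>v\<in>A u. inner (x - u) (y - v) \<ge> 0) \<longrightarrow> y \<in> A x)"
proof safe
  fix x y
  assume A: "maximally_monotone A" and *: "\<forall>u. \<forall>v\<in>A u. inner (x - u) (y - v) \<ge> 0"
  have flip: "inner (u - x) (v - y) = inner (x - u) (y - v)" for u v
    by (metis inner_minus_left inner_minus_right minus_diff_eq minus_minus)
  have "monotone_operator A"
    using A unfolding maximally_monotone_def by blast
  then have "monotone_operator (A(x := insert y (A x)))"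
    using * flip unfolding monotone_operator_def by (simp add: fun_upd_def)
  moreover have "\<forall>z. A z \<subseteq> (A(x := insert y (A x))) z" by auto
  ultimately have "A(x := insert y (A x)) = A"
    using A unfolding maximally_monotone_def by blast
  then show "y \<in> A x" by (metis fun_upd_same insertI1)
next
  assume A: "monotone_operator A"
    and *: "\<forall>x y. (\<forall>u. \<forall>v\<in>A u. inner (x - u) (y - v) \<ge> 0) \<longrightarrow> y \<in> A x"
  show "maximally_monotone A"
    unfolding maximally_monotone_def
  proof (intro conjI allI impI A ext)
    fix A' z assume A': "monotone_operator A' \<and> (\<forall>x. A x \<subseteq> A' x)"
    have "A' z \<subseteq> A z"
    proof
      fix w assume "w \<in> A' z"
      then show "w \<in> A z"
        using * A' unfolding monotone_operator_def by blast
    qed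
    then show "A' z = A z" using A' by blast
  qed
qed (simp add: maximally_monotone_def)

text \<open>
  The inequalities that characterise membership in the graph pass to limits.
\<close>

lemma maximally_monotone_closed_graph:
  assumes A: "maximally_monotone A"
    and x: "x \<longlonglongrightarrow> x'" and y: "y \<longlonglongrightarrow> y'" and xy: "\<And>k. y k \<in> A (x k)"
  shows "y' \<in> A x'"
proof -
  have "inner (x' - u) (y' - v) \<ge> 0" if "v \<in> A u" for u v
  proof (rule LIMSEQ_le_const)
    show "(\<lambda>k. inner (x k - u) (y k - v)) \<longlonglongrightarrow> inner (x' - u) (y' - v)"
      by (intro tendsto_intros x y)
    show "\<exists>N. \<forall>k\<ge>N. 0 \<le> inner (x k - u) (y k - v)"
      using A xy that unfolding maximally_monotone_def monotone_operator_def by blast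
  qed
  then show ?thesis
    using A unfolding maximally_monotone_iff by blast
qed

text \<open>
  Chebyshev's sum inequality for monotone sets: the difference of the two sides is half of the
  nonnegative double sum \<open>\<Sum>p q. c\<^sub>p c\<^sub>q \<langle>a\<^sub>p - a\<^sub>q, b\<^sub>p - b\<^sub>q\<rangle>\<close>.
\<close>

lemma monotone_operator_weighted_means:
  fixes G :: "('a::real_inner \<times> 'a) set"
  assumes mono: "\<And>p q. p \<in> G \<Longrightarrow> q \<in> G \<Longrightarrow> inner (fst p - fst q) (snd p - snd q) \<ge> 0"
    and c: "\<And>p. p \<in> G \<Longrightarrow> 0 \<le> c p" "sum c G = 1"
  shows "inner (\<Sum>p\<in>G. c p *\<^sub>R fst p) (\<Sum>p\<in>G. c p *\<^sub>R snd p) \<le> (\<Sum>p\<in>G. c p * inner (fst p) (snd p))"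
proof -
  let ?a = "\<Sum>p\<in>G. c p *\<^sub>R fst p" and ?b = "\<Sum>p\<in>G. c p *\<^sub>R snd p"
    and ?m = "\<Sum>p\<in>G. c p * inner (fst p) (snd p)"
  have ab: "inner ?a ?b = (\<Sum>p\<in>G. \<Sum>q\<in>G. c p * (c q * inner (fst p) (snd q)))"
    by (subst inner_sum_left, subst inner_sum_right) (simp add: mult.left_commute)
  have ba: "inner ?a ?b = (\<Sum>p\<in>G. \<Sum>q\<in>G. c q * (c p * inner (fst q) (snd p)))"
    unfolding ab by (rule sum.swap)
  have m1: "?m = (\<Sum>p\<in>G. \<Sum>q\<in>G. (c p * inner (fst p) (snd p)) * c q)"
    using sum_product[of "\<lambda>p. c p * inner (fst p) (snd p)" G c G] c(2) by simp
  have m2: "?m = (\<Sum>p\<in>G. \<Sum>q\<in>G. c p * (c q * inner (fst q) (snd q)))"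
    using sum_product[of c G "\<lambda>p. c p * inner (fst p) (snd p)" G] c(2) by simp
  have "0 \<le> (\<Sum>p\<in>G. \<Sum>q\<in>G. c p * c q * inner (fst p - fst q) (snd p - snd q))"
    using mono c(1) by (intro sum_nonneg mult_nonneg_nonneg) auto
  also have "\<dots> = (\<Sum>p\<in>G. \<Sum>q\<in>G. (c p * inner (fst p) (snd p)) * c q + c p * (c q * inner (fst q) (snd q))
      - c p * (c q * inner (fst p) (snd q)) - c q * (c p * inner (fst q) (snd p)))"
    by (intro sum.cong refl) (simp add: inner_diff_left inner_diff_right right_diff_distrib ac_simps)
  also have "\<dots> = ?m + ?m - inner ?a ?b - inner ?a ?b"
    unfolding sum.distrib sum_subtractf m1[symmetric] m2[symmetric] ab[symmetric] ba[symmetric] ..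
  finally show ?thesis by simp
qed

text \<open>
  Expanding the inner product, the point \<open>x\<close> has to satisfy
  \<open>f - 2 \<langle>x, d\<rangle> + |x|\<^sup>2 \<le> 0\<close> for all pairs \<open>(d, f) = ((a - b) / 2, - \<langle>a, b\<rangle>)\<close> with
  \<open>(a, b) \<in> G\<close>. Maximise \<open>s - |x|\<^sup>2\<close> over the points \<open>(x, s)\<close> of the convex hull of these pairs.
  The first-order condition at a maximiser, in the direction of the vertex \<open>(d, f)\<close>, reads
  \<open>f - 2 \<langle>x, d\<rangle> + |x|\<^sup>2 \<le> s - |x|\<^sup>2\<close>. The right-hand side is nonpositive on the entire hull, by
  the inequality for weighted means and \<open>- \<langle>a, b\<rangle> \<le> |a - b|\<^sup>2 / 4\<close>. This is the minimax argument
  behind Kirszbraun's theorem.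
\<close>

lemma minty_finite:
  fixes G :: "('a::real_inner \<times> 'a) set"
  assumes "finite G"
    and mono: "\<And>p q. p \<in> G \<Longrightarrow> q \<in> G \<Longrightarrow> inner (fst p - fst q) (snd p - snd q) \<ge> 0"
  shows "\<exists>x. \<forall>(a, b)\<in>G. inner (x - a) (- x - b) \<ge> 0"
proof (cases "G = {}")
  case False
  define h where "h = (\<lambda>(a, b). ((1 / 2) *\<^sub>R (a - b), - inner a b) :: 'a \<times> real)"
  \<comment> \<open>Vertices of the hull may come from several points of the graph; one representative of each
    is kept so that convex combinations can be pulled back.\<close>
  obtain G' where G': "G' \<subseteq> G" "inj_on h G'" "h ` G = h ` G'"
    using subset_image_inj[of "h ` G" h G] by auto
  have "finite G'"
    using G'(1) \<open>finite G\<close> finite_subset by blast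
  have below: "s \<le> inner q q" if "(q, s) \<in> convex hull (h ` G)" for q s
  proof -
    have "(q, s) \<in> {y. \<exists>u. (\<forall>r\<in>h ` G'. 0 \<le> u r) \<and> sum u (h ` G') = 1 \<and> (\<Sum>r\<in>h ` G'. u r *\<^sub>R r) = y}"
      using that G'(3) convex_hull_finite[OF finite_imageI[OF \<open>finite G'\<close>], of h] by (simp only:)
    then obtain w where w: "\<forall>r\<in>h ` G'. 0 \<le> w r" "sum w (h ` G') = 1"
      "(\<Sum>r\<in>h ` G'. w r *\<^sub>R r) = (q, s)"
      unfolding mem_Collect_eq by (elim exE conjE)
    define c where "c p = w (h p)" for p
    have c: "\<And>p. p \<in> G' \<Longrightarrow> 0 \<le> c p"
      unfolding c_def using w(1) by blast
    have c1: "sum c G' = 1" and c2: "(\<Sum>p\<in>G'. c p *\<^sub>R h p) = (q, s)"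
      using w(2,3) unfolding c_def sum.reindex[OF G'(2)] o_def .
    let ?a = "\<Sum>p\<in>G'. c p *\<^sub>R fst p" and ?b = "\<Sum>p\<in>G'. c p *\<^sub>R snd p"
    have "q = (\<Sum>p\<in>G'. c p *\<^sub>R fst (h p))"
      using arg_cong[OF c2, of fst] by (simp only: fst_sum fst_scaleR fst_conv)
    also have "\<dots> = (1 / 2) *\<^sub>R (?a - ?b)"
      by (simp add: h_def case_prod_beta scaleR_sum_right sum_subtractf[symmetric] scaleR_diff_right)
    finally have q: "q = (1 / 2) *\<^sub>R (?a - ?b)" .
    have "s = (\<Sum>p\<in>G'. c p * snd (h p))"
      using arg_cong[OF c2, of snd] by (simp only: snd_sum snd_scaleR snd_conv real_scaleR_def)
    also have "\<dots> = - (\<Sum>p\<in>G'. c p * inner (fst p) (snd p))"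
      by (simp add: h_def case_prod_beta sum_negf)
    also have "\<dots> \<le> - inner ?a ?b"
      using monotone_operator_weighted_means[OF _ c c1] mono G'(1)
      unfolding neg_le_iff_le by blast
    also have "\<dots> \<le> inner q q"
    proof -
      have "inner ((1 / 2) *\<^sub>R (a - b)) ((1 / 2) *\<^sub>R (a - b)) + inner a b = inner (a + b) (a + b) / 4" for a b :: 'a
        by (simp add: inner_add_left inner_add_right inner_diff_left inner_diff_right inner_commute[of b a] field_simps)
      from this[of ?a ?b] have "inner q q + inner ?a ?b = inner (?a + ?b) (?a + ?b) / 4"
        unfolding q .
      then show ?thesis
        using inner_ge_zero[of "?a + ?b"] by linarith
    qed
    finally show ?thesis .
  qed
  have "compact (convex hull (h ` G))"
    using \<open>finite G\<close> by (intro finite_imp_compact_convex_hull) auto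
  moreover have "convex hull (h ` G) \<noteq> {}"
    using False by simp
  moreover have "continuous_on (convex hull (h ` G)) (\<lambda>z. snd z - inner (fst z) (fst z))"
    by (intro continuous_intros)
  ultimately obtain z where z: "z \<in> convex hull (h ` G)"
    "\<And>z'. z' \<in> convex hull (h ` G) \<Longrightarrow> snd z' - inner (fst z') (fst z') \<le> snd z - inner (fst z) (fst z)"
    by (metis (mono_tags, lifting) continuous_attains_sup)
  obtain x s where xs: "z = (x, s)" by (cases z)
  have "inner (x - a) (- x - b) \<ge> 0" if "(a, b) \<in> G" for a b
  proof -
    define d f where "d = (1 / 2) *\<^sub>R (a - b)" and "f = - inner a b"
    have df: "(d, f) \<in> convex hull (h ` G)"
      using that by (intro hull_inc) (force simp: h_def d_def f_def)
    \<comment> \<open>Compare the maximiser with a point on the segment towards the vertex; then let the step tend to 0.\<close>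
    have *: "f - s - 2 * inner x (d - x) \<le> t * inner (d - x) (d - x)" if t: "0 < t" "t \<le> 1" for t
    proof -
      have "(1 - t) *\<^sub>R z + t *\<^sub>R (d, f) \<in> convex hull (h ` G)"
        using t z(1) df by (intro convexD[OF convex_convex_hull]) auto
      moreover have "(1 - t) *\<^sub>R z + t *\<^sub>R (d, f) = (x + t *\<^sub>R (d - x), s + t * (f - s))"
        by (simp add: xs algebra_simps)
      ultimately have "s + t * (f - s) - inner (x + t *\<^sub>R (d - x)) (x + t *\<^sub>R (d - x)) \<le> s - inner x x"
        using z(2) unfolding xs by fastforce
      moreover have "inner (x + t *\<^sub>R e) (x + t *\<^sub>R e) = inner x x + 2 * t * inner x e + t * t * inner e e" for e
        by (simp add: inner_add_left inner_add_right inner_commute[of e x] algebra_simps)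
      ultimately have "t * (f - s - 2 * inner x (d - x)) \<le> t * (t * inner (d - x) (d - x))"
        by (simp add: right_diff_distrib mult.assoc mult.left_commute)
      then show ?thesis
        using t by (simp only: mult_le_cancel_left_pos)
    qed
    have "((\<lambda>t. t * inner (d - x) (d - x)) \<longlongrightarrow> 0 * inner (d - x) (d - x)) (at_right 0)"
      by (intro tendsto_intros)
    moreover have "\<forall>\<^sub>F t in at_right 0. f - s - 2 * inner x (d - x) \<le> t * inner (d - x) (d - x)"
      unfolding eventually_at_right_field using * by (intro exI[of _ 1]) auto
    ultimately have "f - s - 2 * inner x (d - x) \<le> 0 * inner (d - x) (d - x)"
      by (intro tendsto_lowerbound[where F = "at_right 0"]) auto
    moreover have "s \<le> inner x x"
      using below z(1) unfolding xs .
    moreover have "inner (x - a) (- x - b) = inner x x + 2 * inner x (d - x) - f"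
      unfolding d_def f_def
      by (simp add: inner_diff_left inner_diff_right inner_commute[of a x] inner_commute[of b x])
    ultimately show ?thesis by simp
  qed
  then show ?thesis by blast
qed simp

lemma inner_uminus_nonneg_imp_eq_0:
  assumes "inner z (- z) \<ge> 0"
  shows "z = 0"
proof -
  have "inner z z \<le> 0"
    using assms unfolding inner_minus_right by linarith
  then show ?thesis
    using inner_gt_zero_iff[of z] by linarith
qed

text \<open>
  The points \<open>x\<close> that are monotonically related, together with \<open>u - x\<close>, to one fixed pair of the
  graph form a closed bounded set. Finitely many of these sets have a common point, so by compactness
  all of them do; maximality puts \<open>u - x\<close> into \<open>A x\<close>.
\<close>

theorem minty_surjective:
  fixes A :: "'a::real_inner \<Rightarrow> 'a set"
  assumes fd: "\<exists>S :: 'a set. finite S \<and> span S = UNIV"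
    and A: "maximally_monotone A"
  shows "\<exists>x. u - x \<in> A x"
proof -
  define gr where "gr = {(a, b). b \<in> A a}"
  define C where "C = (\<lambda>(a, b). {x. inner (x - a) ((u - x) - b) \<ge> 0})"
  have mono: "inner (a - a') (b - b') \<ge> 0" if "(a, b) \<in> gr" "(a', b') \<in> gr" for a b a' b'
    using A that unfolding gr_def maximally_monotone_def monotone_operator_def by blast
  have "\<exists>a b. b \<in> A a"
    using A unfolding maximally_monotone_iff by blast
  then obtain a0 b0 where ab0: "(a0, b0) \<in> gr"
    unfolding gr_def by blast
  define K where "K = cball a0 (norm (u - b0 - a0))"
  have C_K: "C (a0, b0) \<subseteq> K"
  proof
    fix x assume "x \<in> C (a0, b0)"
    then have "norm (x - a0) * norm (x - a0) \<le> inner (x - a0) (u - b0 - a0)"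
      unfolding C_def power2_eq_square[symmetric] power2_norm_eq_inner
      by (simp add: inner_diff_left inner_diff_right inner_commute[of a0 x] algebra_simps)
    also have "\<dots> \<le> norm (x - a0) * norm (u - b0 - a0)"
      by (rule norm_cauchy_schwarz)
    finally have "norm (x - a0) \<le> norm (u - b0 - a0)"
      by (cases "norm (x - a0) = 0") (auto simp: mult_le_cancel_left)
    then show "x \<in> K"
      unfolding K_def by (simp add: dist_norm norm_minus_commute)
  qed
  have "K \<inter> (\<Inter>p\<in>gr. C p) \<noteq> {}"
  proof (rule compact_imp_fip_image)
    show "compact K"
      unfolding K_def by (rule compact_cball_finite_dimensional[OF fd])
    show "closed (C p)" for p
      unfolding C_def by (cases p) (auto intro!: closed_Collect_le continuous_intros)
  next
    fix G assume G: "finite G" "G \<subseteq> gr"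
    define G' where "G' = (\<lambda>(a, b). (a, b - u)) ` insert (a0, b0) G"
    have "\<exists>x. \<forall>(a, b)\<in>G'. inner (x - a) (- x - b) \<ge> 0"
    proof (rule minty_finite)
      show "finite G'"
        using G unfolding G'_def by simp
      show "inner (fst p - fst q) (snd p - snd q) \<ge> 0" if pq: "p \<in> G'" "q \<in> G'" for p q
      proof -
        obtain a b where ab: "(a, b) \<in> gr" "p = (a, b - u)"
          using pq(1) G(2) ab0 unfolding G'_def by auto
        obtain a' b' where ab': "(a', b') \<in> gr" "q = (a', b' - u)"
          using pq(2) G(2) ab0 unfolding G'_def by auto
        show ?thesis
          using mono[OF ab(1) ab'(1)] unfolding ab(2) ab'(2) by simp
      qed
    qed
    then obtain x where x: "\<And>a b. (a, b) \<in> insert (a0, b0) G \<Longrightarrow> inner (x - a) (- x - (b - u)) \<ge> 0"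
      unfolding G'_def by fast
    have "x \<in> C p" if "p \<in> insert (a0, b0) G" for p
      using x[of "fst p" "snd p"] that unfolding C_def by (simp add: case_prod_beta algebra_simps)
    then show "K \<inter> (\<Inter>p\<in>G. C p) \<noteq> {}"
      using C_K by blast
  qed
  then obtain x where "\<forall>p\<in>gr. x \<in> C p"
    by blast
  then have "\<forall>a. \<forall>b\<in>A a. inner (x - a) ((u - x) - b) \<ge> 0"
    unfolding gr_def C_def by auto
  then show ?thesis
    using A unfolding maximally_monotone_iff by blast
qed

text \<open>
  The converse of Minty's theorem. It gives maximality of product operators: a pair related to a
  product graph says nothing about the components separately, as the other components need not
  lie in the domains, whereas surjectivity can be checked componentwise.
\<close>

lemma monotone_surjective_imp_maximally_monotone:
  assumes mono: "monotone_operator A" and surj: "\<And>u. \<exists>x. u - x \<in> A x"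
  shows "maximally_monotone A"
  unfolding maximally_monotone_iff
proof (intro conjI mono allI impI)
  fix x y assume *: "\<forall>u. \<forall>v\<in>A u. inner (x - u) (y - v) \<ge> 0"
  \<comment> \<open>Solve the resolvent equation for the sum of the related pair; monotonicity then forces the
    solution to be the pair itself.\<close>
  obtain z where z: "(x + y) - z \<in> A z"
    using surj by blast
  then have "inner (x - z) (y - ((x + y) - z)) \<ge> 0"
    using * by blast
  moreover have "y - ((x + y) - z) = - (x - z)"
    by simp
  ultimately have "x = z"
    using inner_uminus_nonneg_imp_eq_0[of "x - z"] by simp
  then show "y \<in> A x"
    using z by simp
qed

lemma monotone_prod_operator:
  fixes A :: "'n::finite \<Rightarrow> 'a::real_inner \<Rightarrow> 'a set"
  assumes "\<And>i. monotone_operator (A i)"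
  shows "monotone_operator (prod_operator A)"
  unfolding monotone_operator_def
proof (intro allI ballI)
  fix x u y v assume "y \<in> prod_operator A x" "v \<in> prod_operator A u"
  then have "inner (x $ i - u $ i) (y $ i - v $ i) \<ge> 0" for i
    using assms[of i] unfolding monotone_operator_def prod_operator_def by blast
  then show "inner (x - u) (y - v) \<ge> 0"
    unfolding inner_vec_def by (simp add: sum_nonneg)
qed

lemma maximally_monotone_prod_operator:
  fixes A :: "'n::finite \<Rightarrow> 'a::real_inner \<Rightarrow> 'a set"
  assumes "\<exists>S :: 'a set. finite S \<and> span S = UNIV" "\<And>i. maximally_monotone (A i)"
  shows "maximally_monotone (prod_operator A)"
proof (rule monotone_surjective_imp_maximally_monotone)
  show "monotone_operator (prod_operator A)"
    using assms by (intro monotone_prod_operator) (simp add: maximally_monotone_def)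
  fix u :: "'a ^ 'n"
  have "\<forall>i. \<exists>x. u $ i - x \<in> A i x"
    using minty_surjective assms by blast
  then obtain x where "\<forall>i. u $ i - x i \<in> A i (x i)"
    by metis
  then show "\<exists>x. u - x \<in> prod_operator A x"
    by (intro exI[of _ "\<chi> i. x i"]) (simp add: prod_operator_def)
qed

lemma mem_scale_operator_iff:
  assumes "t \<noteq> 0"
  shows "y \<in> scale_operator t A x \<longleftrightarrow> (1 / t) *\<^sub>R y \<in> A x"
proof -
  have "y = t *\<^sub>R ((1 / t) *\<^sub>R y)"
    using assms by simp
  then show ?thesis
    unfolding scale_operator_def using assms by force
qed

lemma maximally_monotone_scale_operator:
  assumes A: "maximally_monotone A" and "t > 0"
  shows "maximally_monotone (scale_operator t A)"
  unfolding maximally_monotone_iff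
proof (intro conjI allI impI)
  have "inner (x - u) (y - v) \<ge> 0" if "y \<in> A x" "v \<in> A u" for x u y v
    using A that unfolding maximally_monotone_def monotone_operator_def by blast
  then show "monotone_operator (scale_operator t A)"
    unfolding monotone_operator_def scale_operator_def using \<open>t > 0\<close>
    by (auto simp flip: scaleR_diff_right)
  fix x y assume *: "\<forall>u. \<forall>v\<in>scale_operator t A u. inner (x - u) (y - v) \<ge> 0"
  have "inner (x - u) ((1 / t) *\<^sub>R y - v) \<ge> 0" if "v \<in> A u" for u v
  proof -
    have "inner (x - u) (y - t *\<^sub>R v) \<ge> 0"
      using * that unfolding scale_operator_def by blast
    moreover have "y - t *\<^sub>R v = t *\<^sub>R ((1 / t) *\<^sub>R y - v)"
      using \<open>t > 0\<close> by (simp add: scaleR_diff_right)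
    ultimately show ?thesis
      using \<open>t > 0\<close> by (simp only: inner_scaleR_right zero_le_mult_iff) auto
  qed
  then have "(1 / t) *\<^sub>R y \<in> A x"
    using A unfolding maximally_monotone_iff by blast
  then show "y \<in> scale_operator t A x"
    using \<open>t > 0\<close> by (simp add: mem_scale_operator_iff)
qed

text \<open>
  Surjectivity of \<open>Id + A\<close> gives a solution of the resolvent equation and monotonicity its
  uniqueness, so the value of the resolvent is not the arbitrary element of an ill-formed singleton.
\<close>

lemma resolvent_mem:
  fixes A :: "'a::real_inner \<Rightarrow> 'a set"
  assumes fd: "\<exists>S :: 'a set. finite S \<and> span S = UNIV"
    and A: "maximally_monotone A"
  shows "u - resolvent A u \<in> A (resolvent A u)"
proof -
  have inv: "inverse_operator (\<lambda>x. {x} + A x) u = {x. u - x \<in> A x}"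
    unfolding inverse_operator_def set_plus_def by (force simp: algebra_simps intro: bexI[of _ "u - _"])
  obtain x where x: "u - x \<in> A x"
    using minty_surjective[OF fd A] by blast
  have "z = x" if "u - z \<in> A z" for z
  proof -
    have "inner (x - z) ((u - x) - (u - z)) \<ge> 0"
      using A x that unfolding maximally_monotone_def monotone_operator_def by blast
    moreover have "(u - x) - (u - z) = - (x - z)"
      by simp
    ultimately show ?thesis
      using inner_uminus_nonneg_imp_eq_0[of "x - z"] by simp
  qed
  then have "{x. u - x \<in> A x} = {x}"
    using x by blast
  then show ?thesis
    using x unfolding resolvent_def inv by simp
qed

section \<open>Matrices acting on product spaces\<close>

lemma inner_mat_act:
  "inner a (mat_act W b) = (\<Sum>i\<in>UNIV. \<Sum>j\<in>UNIV. W $ i $ j * inner (a $ i) (b $ j))"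
  by (simp add: inner_vec_def mat_act_def inner_sum_right)

lemma mat_act_real: "mat_act W x = W *v (x :: real ^ 'n)"
  by (simp add: mat_act_def matrix_vector_mult_def)

lemma mat_act_minus_matrix: "mat_act (V - W) x = mat_act V x - mat_act W x"
  by (simp add: mat_act_def vec_eq_iff scaleR_diff_left sum_subtractf)

lemma mat_act_plus_matrix: "mat_act (V + W) x = mat_act V x + mat_act W x"
  by (simp add: mat_act_def vec_eq_iff scaleR_add_left sum.distrib)

lemma mat_act_scaleR_matrix: "mat_act (c *\<^sub>R W) x = c *\<^sub>R mat_act W x"
  by (simp add: mat_act_def vec_eq_iff scaleR_sum_right)

lemma mat_act_one: "mat_act (mat 1) x = (x :: 'a::real_vector ^ 'n)"
proof -
  have "(\<Sum>j\<in>UNIV. (mat 1 :: real ^ 'n ^ 'n) $ i $ j *\<^sub>R x $ j) = (\<Sum>j\<in>UNIV. if j = i then x $ j else 0)" for i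
    by (intro sum.cong) (auto simp: mat_def)
  then show ?thesis
    by (simp add: mat_act_def vec_eq_iff)
qed

lemma mat_act_mult: "mat_act (V ** W) x = mat_act V (mat_act W x)"
proof -
  have "(\<Sum>j\<in>UNIV. \<Sum>k\<in>UNIV. (V $ i $ k * W $ k $ j) *\<^sub>R x $ j)
      = (\<Sum>k\<in>UNIV. \<Sum>j\<in>UNIV. (V $ i $ k * W $ k $ j) *\<^sub>R x $ j)" for i
    by (rule sum.swap)
  then show ?thesis
    by (simp add: mat_act_def vec_eq_iff matrix_matrix_mult_def scaleR_sum_left scaleR_sum_right)
qed

lemma linear_mat_act: "linear (mat_act W)"
  by (intro linearI) (simp_all add: mat_act_def vec_eq_iff scaleR_add_right sum.distrib scaleR_sum_right mult.commute)

lemma bounded_linear_mat_act: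
  "bounded_linear (mat_act W :: 'a::real_normed_vector ^ 'n \<Rightarrow> 'a ^ 'n)"
proof -
  interpret linear "mat_act W :: 'a ^ 'n \<Rightarrow> 'a ^ 'n"
    by (rule linear_mat_act)
  show ?thesis
  proof (rule bounded_linear_intro[of _ "\<Sum>i\<in>UNIV. \<Sum>j\<in>UNIV. \<bar>W $ i $ j\<bar>"])
    fix x :: "'a ^ 'n"
    have "norm (mat_act W x) \<le> (\<Sum>i\<in>UNIV. norm (mat_act W x $ i))"
      unfolding norm_vec_def by (intro L2_set_le_sum) simp
    also have "\<dots> \<le> (\<Sum>i\<in>UNIV. \<Sum>j\<in>UNIV. \<bar>W $ i $ j\<bar> * norm x)"
    proof (rule sum_mono)
      fix i
      have "norm (mat_act W x $ i) \<le> (\<Sum>j\<in>UNIV. norm (W $ i $ j *\<^sub>R x $ j))"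
        unfolding mat_act_def by (simp only: vec_lambda_beta norm_sum)
      also have "\<dots> \<le> (\<Sum>j\<in>UNIV. \<bar>W $ i $ j\<bar> * norm x)"
        by (intro sum_mono) (simp add: Finite_Cartesian_Product.norm_nth_le mult_left_mono)
      finally show "norm (mat_act W x $ i) \<le> (\<Sum>j\<in>UNIV. \<bar>W $ i $ j\<bar> * norm x)" .
    qed
    finally show "norm (mat_act W x) \<le> norm x * (\<Sum>i\<in>UNIV. \<Sum>j\<in>UNIV. \<bar>W $ i $ j\<bar>)"
      by (simp add: sum_distrib_left mult.commute)
  qed (simp_all add: add scale)
qed

lemma inner_mat_act_symmetric:
  assumes "transpose W = W"
  shows "inner (mat_act W a) b = inner a (mat_act W b)"
proof -
  have W: "W $ i $ j = W $ j $ i" for i j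
    using assms by (metis transpose_def vec_lambda_beta)
  have "inner a (mat_act W b) = (\<Sum>i\<in>UNIV. \<Sum>j\<in>UNIV. W $ j $ i * inner (b $ j) (a $ i))"
    unfolding inner_mat_act by (intro sum.cong refl) (metis W inner_commute)
  also have "\<dots> = (\<Sum>i\<in>UNIV. \<Sum>j\<in>UNIV. W $ i $ j * inner (b $ i) (a $ j))"
    by (rule sum.swap)
  also have "\<dots> = inner (mat_act W a) b"
    unfolding inner_mat_act[symmetric] by (rule inner_commute)
  finally show ?thesis ..
qed

text \<open>
  In coordinates with respect to an orthogonal basis of the factor space the action splits into
  one copy of the matrix for each basis vector.
\<close>

lemma mat_act_positive_semidefinite:
  fixes a :: "'a::real_inner ^ 'n"
  assumes fd: "\<exists>S :: 'a set. finite S \<and> span S = UNIV"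
    and Q: "\<And>c :: real ^ 'n. inner c (Q *v c) \<ge> 0"
  shows "inner a (mat_act Q a) \<ge> 0"
proof -
  obtain S0 :: "'a set" where "finite S0" "span S0 = UNIV"
    using fd by blast
  then obtain S :: "'a set" where S: "finite S" "span S = UNIV" "pairwise orthogonal S"
    using basis_orthogonal[of S0] by auto
  define s where "s e = (\<chi> i. inner (a $ i) e)" for e
  have "inner a (mat_act Q a) = (\<Sum>i\<in>UNIV. \<Sum>j\<in>UNIV. \<Sum>e\<in>S. Q $ i $ j * (s e $ i * s e $ j) / inner e e)"
    unfolding inner_mat_act s_def by (subst parseval_inner[OF S]) (simp add: sum_distrib_left)
  also have "\<dots> = (\<Sum>i\<in>UNIV. \<Sum>e\<in>S. \<Sum>j\<in>UNIV. Q $ i $ j * (s e $ i * s e $ j) / inner e e)"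
    by (intro sum.cong refl sum.swap)
  also have "\<dots> = (\<Sum>e\<in>S. \<Sum>i\<in>UNIV. \<Sum>j\<in>UNIV. Q $ i $ j * (s e $ i * s e $ j) / inner e e)"
    by (rule sum.swap)
  also have "\<dots> = (\<Sum>e\<in>S. inner (s e) (Q *v s e) / inner e e)"
    unfolding mat_act_real[symmetric] inner_mat_act by (simp add: sum_divide_distrib)
  also have "\<dots> \<ge> 0"
    using Q by (intro sum_nonneg divide_nonneg_nonneg) auto
  finally show ?thesis .
qed

section \<open>The smallest eigenvalue\<close>

text \<open>
  Eigenvectors of different eigenvalues are orthogonal, so the spectrum is finite and its minimum is
  a lower bound of it. The minimum of the Rayleigh quotient over the unit sphere is attained and is an
  eigenvalue, hence no smaller than \<open>lambda_min W\<close>.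
\<close>

lemma lambda_min_properties:
  fixes W :: "real ^ 'n ^ 'n"
  assumes sym: "transpose W = W"
  shows lambda_min_le_eigenvalue: "\<And>l z. z \<noteq> 0 \<Longrightarrow> W *v z = l *\<^sub>R z \<Longrightarrow> lambda_min W \<le> l"
    and lambda_min_le_rayleigh: "\<And>z. lambda_min W * inner z z \<le> inner z (W *v z)"
proof -
  have symW: "inner (W *v a) b = inner a (W *v b)" for a b
    using inner_mat_act_symmetric[OF sym, of a b] by (simp add: mat_act_real)
  define Sp where "Sp = {l. \<exists>z. z \<noteq> 0 \<and> W *v z = l *\<^sub>R z}"
  have "\<exists>f. \<forall>l\<in>Sp. f l \<noteq> 0 \<and> W *v f l = l *\<^sub>R f l"
    unfolding Sp_def by (intro bchoice) blast
  then obtain f where f: "\<And>l. l \<in> Sp \<Longrightarrow> f l \<noteq> 0" "\<And>l. l \<in> Sp \<Longrightarrow> W *v f l = l *\<^sub>R f l"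
    by blast
  have orth: "inner (f l) (f m) = 0" if "l \<in> Sp" "m \<in> Sp" "l \<noteq> m" for l m
    using symW[of "f l" "f m"] f(2)[of l] f(2)[of m] that by simp
  have "inj_on f Sp"
    using orth f(1) by (metis inj_onI inner_eq_zero_iff)
  moreover have "finite (f ` Sp)"
  proof (intro independent_imp_finite pairwise_orthogonal_independent)
    show "pairwise orthogonal (f ` Sp)"
      using orth unfolding pairwise_def orthogonal_def by blast
    show "0 \<notin> f ` Sp"
      using f(1) by force
  qed
  ultimately have fin: "finite Sp"
    using finite_imageD by blast
  show le: "lambda_min W \<le> l" if "z \<noteq> 0" "W *v z = l *\<^sub>R z" for l z
    unfolding lambda_min_def Sp_def[symmetric] using fin that
    by (intro Min_le) (auto simp: Sp_def)
  have "continuous_on (sphere 0 1) (\<lambda>z. inner z (W *v z))"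
    by (intro continuous_intros linear_continuous_on matrix_vector_mul_bounded_linear)
  moreover have "sphere (0 :: real ^ 'n) 1 \<noteq> {}"
    by simp
  ultimately obtain e where e: "norm e = 1"
    "\<And>z. norm z = 1 \<Longrightarrow> inner e (W *v e) \<le> inner z (W *v z)"
    using continuous_attains_inf[OF compact_sphere, of 0 1 "\<lambda>z. inner z (W *v z)"] by auto
  define m where "m = inner e (W *v e)"
  define Q where "Q z = inner z (W *v z) - m * inner z z" for z
  have Q: "Q z \<ge> 0" for z
  proof (cases "z = 0")
    case False
    have "m \<le> inner (z /\<^sub>R norm z) (W *v (z /\<^sub>R norm z))"
      unfolding m_def using False by (intro e) simp
    also have "\<dots> = inner z (W *v z) / (norm z)\<^sup>2"
      by (simp add: matrix_vector_mult_scaleR power2_eq_square field_simps)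
    finally show ?thesis
      using False unfolding Q_def power2_norm_eq_inner[symmetric] by (simp add: field_simps)
  qed (simp add: Q_def)
  define w where "w = W *v e - m *\<^sub>R e"
  have ee: "inner e e = 1"
    using e(1) by (simp add: norm_eq_1)
  \<comment> \<open>The nonnegative form \<open>Q\<close> vanishes at the minimiser \<open>e\<close>; moving from \<open>e\<close> against its
    gradient \<open>2 w\<close> shows that the gradient is zero.\<close>
  have "2 * inner w w \<le> s * Q w" if "s > 0" for s
  proof -
    have "Q (e - s *\<^sub>R w) = Q e - 2 * s * (inner w (W *v e) - m * inner w e) + s * s * Q w"
      unfolding Q_def
      by (simp add: matrix_vector_mult_diff_distrib matrix_vector_mult_scaleR inner_diff_left inner_diff_right
          symW[symmetric, of e w] inner_commute[of "W *v e" w] inner_commute[of e w] algebra_simps)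
    also have "inner w (W *v e) - m * inner w e = inner w w"
      unfolding w_def by (simp add: inner_diff_right)
    also have "Q e = 0"
      unfolding Q_def m_def ee by simp
    finally have "s * (2 * inner w w) \<le> s * (s * Q w)"
      using Q[of "e - s *\<^sub>R w"] by (simp add: algebra_simps)
    then show ?thesis
      using that by (simp only: mult_le_cancel_left_pos)
  qed
  then have *: "\<forall>\<^sub>F s in at_right 0. 2 * inner w w \<le> s * Q w"
    unfolding eventually_at_right_field by (intro exI[of _ 1]) auto
  have "((\<lambda>s. s * Q w) \<longlongrightarrow> 0 * Q w) (at_right 0)"
    by (intro tendsto_intros)
  then have "2 * inner w w \<le> 0 * Q w"
    by (rule tendsto_lowerbound[OF _ *]) simp
  then have "inner w w = 0"
    using inner_ge_zero[of w] by simp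
  then have "W *v e = m *\<^sub>R e"
    unfolding w_def by simp
  then have "lambda_min W \<le> m"
    using e(1) by (intro le[of e]) auto
  then show "lambda_min W * inner z z \<le> inner z (W *v z)" for z
    using Q[of z] mult_right_mono[OF _ inner_ge_zero[of z], of "lambda_min W" m] unfolding Q_def by linarith
qed

section \<open>Solving the Laplacian equation\<close>

lemma sum_mat_act_eq_0:
  assumes "\<And>j. (\<Sum>i\<in>UNIV. M $ i $ j) = 0"
  shows "(\<Sum>i\<in>UNIV. mat_act M y $ i) = 0"
proof -
  have "(\<Sum>i\<in>UNIV. mat_act M y $ i) = (\<Sum>j\<in>UNIV. \<Sum>i\<in>UNIV. M $ i $ j *\<^sub>R y $ j)"
    unfolding mat_act_def by (subst sum.swap) simp
  also have "\<dots> = (\<Sum>j\<in>UNIV. (\<Sum>i\<in>UNIV. M $ i $ j) *\<^sub>R y $ j)"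
    by (simp add: scaleR_sum_left)
  finally show ?thesis
    using assms by simp
qed

text \<open>
  Adding the all-ones matrix \<open>P\<close> makes \<open>M\<close> injective: positivity of both forms forces a
  vector in the kernel of the sum to have component sum zero, so it is annihilated by \<open>P\<close>, hence by
  \<open>M\<close>, hence constant and zero. The inverse of \<open>M + P\<close> serves as \<open>N\<close>: if
  \<open>(M + P) z = g\<close> and the components of \<open>g\<close> sum to zero, then so do those of \<open>P z = g - M z\<close>. As
  \<open>P z\<close> is constant, it vanishes and \<open>M z = g\<close>. Being a real matrix, \<open>N\<close> acts
  on every product space.
\<close>

lemma mean_zero_right_inverse:
  fixes M :: "real ^ 'n ^ 'n"
  assumes psd: "\<And>c. inner c (M *v c) \<ge> 0"
    and ker: "\<And>c. M *v c = 0 \<Longrightarrow> \<forall>i j. c $ i = c $ j"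
    and colsum: "\<And>j. (\<Sum>i\<in>UNIV. M $ i $ j) = 0"
  obtains N where "\<And>g :: 'a::real_vector ^ 'n. (\<Sum>i\<in>UNIV. g $ i) = 0 \<Longrightarrow> mat_act M (mat_act N g) = g"
proof -
  define P :: "real ^ 'n ^ 'n" where "P = (\<chi> i j. 1)"
  have P: "mat_act P z $ i = (\<Sum>j\<in>UNIV. z $ j)" for z :: "'b::real_vector ^ 'n" and i
    unfolding P_def mat_act_def by simp
  have "c = 0" if c: "(M + P) *v c = 0" for c
  proof -
    have "inner c (P *v c) = (\<Sum>i\<in>UNIV. c $ i)\<^sup>2"
      unfolding mat_act_real[symmetric] inner_vec_def P
      by (simp add: power2_eq_square sum_distrib_right)
    moreover have "inner c (M *v c) + inner c (P *v c) = 0"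
      using c by (simp add: matrix_vector_mult_add_rdistrib flip: inner_add_right)
    ultimately have "(\<Sum>i\<in>UNIV. c $ i)\<^sup>2 \<le> 0"
      using psd[of c] by linarith
    then have sum0: "(\<Sum>i\<in>UNIV. c $ i) = 0"
      by simp
    then have "P *v c = 0"
      unfolding mat_act_real[symmetric] vec_eq_iff P by simp
    then have "M *v c = 0"
      using c by (simp add: matrix_vector_mult_add_rdistrib)
    then have const: "c $ i = c $ j" for i j
      using ker by blast
    have "c $ i = 0" for i
    proof -
      have "(\<Sum>j\<in>UNIV. c $ j) = (\<Sum>j\<in>(UNIV :: 'n set). c $ i)"
        using const by (intro sum.cong) auto
      then show ?thesis
        using sum0 by simp
    qed
    then show ?thesis
      by (simp add: vec_eq_iff)
  qed
  then obtain N where "N ** (M + P) = mat 1"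
    using matrix_left_invertible_ker[of "M + P"] by blast
  then have N: "(M + P) ** N = mat 1"
    using matrix_left_right_inverse by blast
  show thesis
  proof (rule that[of N])
    fix g :: "'a ^ 'n" assume g: "(\<Sum>i\<in>UNIV. g $ i) = 0"
    define z where "z = mat_act N g"
    have "mat_act (M + P) z = g"
      unfolding z_def mat_act_mult[symmetric] N mat_act_one ..
    then have z: "mat_act M z + mat_act P z = g"
      by (simp add: mat_act_plus_matrix)
    have "(\<Sum>i\<in>UNIV. mat_act M z $ i) + (\<Sum>i\<in>UNIV. mat_act P z $ i) = 0"
      using g unfolding z[symmetric] by (simp add: sum.distrib)
    then have "(\<Sum>j\<in>UNIV. z $ j) = 0"
      unfolding sum_mat_act_eq_0[OF colsum] P by (simp add: sum_constant_scaleR)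
    then have "mat_act P z = 0"
      by (simp add: vec_eq_iff P)
    then show "mat_act M (mat_act N g) = g"
      using z unfolding z_def by simp
  qed
qed

section \<open>The primal-dual iteration\<close>

text \<open>
  The step size is absorbed into \<open>T\<close> and \<open>F\<close>. The operator \<open>N\<close> is a generalised inverse of
  \<open>M\<close>: it recovers, up to the kernel of \<open>M\<close>, a dual vector from its image, which is all that
  is controlled of the dual sequence. Truncated subtraction makes \<open>x (k - 1)\<close> equal to \<open>x 0\<close>
  for \<open>k = 0\<close>, in accordance with the initialisation of the algorithm.
\<close>

locale primal_dual_iteration =
  fixes T :: "'a::real_inner \<Rightarrow> 'a set"
    and F M N :: "'a \<Rightarrow> 'a"
    and l \<mu> :: real
    and x y :: "nat \<Rightarrow> 'a"
  assumes finite_dim: "\<exists>S :: 'a set. finite S \<and> span S = UNIV"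
    and T_maximal: "maximally_monotone T"
    and F_monotone: "inner (a - b) (F a - F b) \<ge> 0"
    and F_lipschitz: "norm (F a - F b) \<le> l * norm (a - b)"
    and M_linear: "bounded_linear M"
    and M_symmetric: "inner (M a) b = inner a (M b)"
    and M_psd: "inner a (M a) \<ge> 0"
    and M_bound: "inner a (M a) \<le> (1 - \<mu>) * inner a a"
    and N_linear: "bounded_linear N"
    and N_inverse: "M (N (M a)) = M a"
    and l_nonneg: "0 \<le> l"
    and l_less: "2 * l < \<mu>"
    and \<mu>_le_1: "\<mu> \<le> 1"
    and y_step: "y (Suc k) = y k + x (Suc k)"
    and x_step: "x k - x (Suc k) - (2 *\<^sub>R F (x k) - F (x (k - 1))) - M (y k + x k) \<in> T (x (Suc k))"
begin

text \<open>
  The vector \<open>q\<close> is a multiplier for the constraint \<open>M p = 0\<close> of the inclusion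
  \<open>0 \<in> T p + F p\<close>.
\<close>

definition saddle_point :: "'a \<Rightarrow> 'a \<Rightarrow> bool" where
  "saddle_point p q \<longleftrightarrow> M p = 0 \<and> - F p - M q \<in> T p"

text \<open>
  The Lyapunov function. The squared distance is taken in the seminorm of \<open>M\<close> for the dual
  variable; the cross term is what the reflected evaluations of \<open>F\<close> leave behind when telescoped, and
  the last term keeps the energy nonnegative in spite of it.
\<close>

definition energy :: "'a \<Rightarrow> 'a \<Rightarrow> nat \<Rightarrow> real" where
  "energy p q k = (norm (x k - p))\<^sup>2 + inner (y k - q) (M (y k - q))
     - 2 * inner (F (x k) - F (x (k - 1))) (x k - p) + l * (norm (x k - x (k - 1)))\<^sup>2"

sublocale M: bounded_linear M by (rule M_linear)
sublocale N: bounded_linear N by (rule N_linear)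

text \<open>
  Since \<open>0 \<le> M \<le> I\<close>, positivity of the form of \<open>M\<close> at \<open>a - M a\<close> gives \<open>M\<^sup>2 \<le> M\<close>.
\<close>

lemma norm_M_le: "(norm (M a))\<^sup>2 \<le> inner a (M a)"
proof -
  have "inner (M a) (M (M a)) \<le> (1 - \<mu>) * inner (M a) (M a)"
    by (rule M_bound)
  also have "\<dots> \<le> inner (M a) (M a)"
    using l_nonneg l_less by (intro mult_left_le_one_le) (auto simp: \<mu>_le_1)
  finally have "inner (M a) (M (M a)) \<le> inner (M a) (M a)" .
  moreover have "inner (a - M a) (M (a - M a)) = inner a (M a) - 2 * inner (M a) (M a) + inner (M a) (M (M a))"
    using M_symmetric[of a "M a"] inner_commute[of "M a" a]
    by (simp add: M.diff inner_diff_left inner_diff_right)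
  ultimately show ?thesis
    using M_psd[of "a - M a"] unfolding power2_norm_eq_inner by linarith
qed

lemma forward_difference_bound:
  "2 * \<bar>inner (F a - F b) c\<bar> \<le> l * (norm (a - b))\<^sup>2 + l * (norm c)\<^sup>2"
proof -
  have "\<bar>inner (F a - F b) c\<bar> \<le> norm (F a - F b) * norm c"
    by (rule Cauchy_Schwarz_ineq2)
  also have "\<dots> \<le> l * norm (a - b) * norm c"
    by (intro mult_right_mono F_lipschitz) simp
  finally have "2 * \<bar>inner (F a - F b) c\<bar> \<le> l * (2 * norm (a - b) * norm c)"
    by simp
  also have "\<dots> \<le> l * ((norm (a - b))\<^sup>2 + (norm c)\<^sup>2)"
    by (intro mult_left_mono l_nonneg sum_squares_bound)
  finally show ?thesis
    by (simp add: distrib_left)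
qed

text \<open>
  Monotonicity of \<open>T\<close> between the new iterate and the saddle point is an inequality whose three
  parts telescope separately: the proximal part by the law of cosines, the forward part up to
  \<open>\<langle>F x\<^sub>k - F x\<^sub>k\<^sub>-\<^sub>1, x\<^sub>k\<^sub>+\<^sub>1 - x\<^sub>k\<rangle>\<close>, and the dual part up to the \<open>M\<close>-seminorm of the last step.
  The remainders are absorbed by \<open>|x\<^sub>k\<^sub>+\<^sub>1 - x\<^sub>k|\<^sup>2\<close> because \<open>1 - (1 - \<mu>) - 2 l > 0\<close>.
\<close>

lemma energy_decrease:
  assumes "saddle_point p q"
  shows "energy p q (Suc k) + (\<mu> - 2 * l) * (norm (x (Suc k) - x k))\<^sup>2 + inner (x k) (M (x k)) \<le> energy p q k"
proof -
  define a b e Y where "a = x k" and "b = x (Suc k)" and "e = x (k - 1)" and "Y = y k"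
  have Mp: "M p = 0" and p: "- F p - M q \<in> T p"
    using assms by (auto simp: saddle_point_def)
  have "inner (b - p) ((a - b - (2 *\<^sub>R F a - F e) - M (Y + a)) - (- F p - M q)) \<ge> 0"
    using T_maximal x_step[of k] p unfolding maximally_monotone_def monotone_operator_def a_def b_def e_def Y_def
    by blast
  also have "(a - b - (2 *\<^sub>R F a - F e) - M (Y + a)) - (- F p - M q)
      = (a - b) + (F p - 2 *\<^sub>R F a + F e) + (M q - M (Y + a))"
    by simp
  finally have T_mono: "0 \<le> inner (b - p) (a - b) + inner (b - p) (F p - 2 *\<^sub>R F a + F e) + inner (b - p) (M q - M (Y + a))"
    by (simp add: inner_add_right)
  have 1: "2 * inner (b - p) (a - b) = (norm (a - p))\<^sup>2 - (norm (b - p))\<^sup>2 - (norm (b - a))\<^sup>2"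
    unfolding power2_norm_eq_inner
    by (simp add: inner_diff_left inner_diff_right inner_commute[of b a] inner_commute[of p a] inner_commute[of p b])
  have 2: "inner (b - p) (F p - 2 *\<^sub>R F a + F e) = - inner (b - p) (F b - F p)
      + inner (F b - F a) (b - p) - inner (F a - F e) (a - p) - inner (F a - F e) (b - a)"
    by (simp add: inner_diff_left inner_diff_right inner_add_left inner_add_right inner_commute[of "F _"])
  have M_sym: "inner c (M d) = inner d (M c)" for c d
    by (metis M_symmetric inner_commute)
  have pM: "inner p (M c) = 0" for c
    using M_sym[of p c] Mp by simp
  have 3: "2 * inner (b - p) (M q - M (Y + a)) = inner (Y - q) (M (Y - q)) - inner (Y + b - q) (M (Y + b - q))
      + inner (b - a) (M (b - a)) - inner a (M a)"
    by (simp add: M.diff M.add inner_diff_left inner_diff_right inner_add_left inner_add_right pM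
        M_sym[of b Y] M_sym[of b a] M_sym[of b q] M_sym[of Y q] M_sym[of Y a] M_sym[of a q])
  have 4: "inner (b - a) (M (b - a)) \<le> (1 - \<mu>) * (norm (b - a))\<^sup>2"
    unfolding power2_norm_eq_inner by (rule M_bound)
  have 5: "- 2 * inner (F a - F e) (b - a) \<le> l * (norm (a - e))\<^sup>2 + l * (norm (b - a))\<^sup>2"
    using forward_difference_bound[of a e "b - a"] by linarith
  have "energy p q (Suc k) = (norm (b - p))\<^sup>2 + inner (Y + b - q) (M (Y + b - q)) - 2 * inner (F b - F a) (b - p)
      + l * (norm (b - a))\<^sup>2"
    unfolding energy_def y_step a_def b_def Y_def by simp
  moreover have "energy p q k = (norm (a - p))\<^sup>2 + inner (Y - q) (M (Y - q)) - 2 * inner (F a - F e) (a - p)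
      + l * (norm (a - e))\<^sup>2"
    unfolding energy_def a_def e_def Y_def by simp
  ultimately show ?thesis
    using T_mono 1 2 3 4 5 F_monotone[of b p] unfolding a_def[symmetric] b_def[symmetric]
    by (simp add: algebra_simps)
qed

lemma energy_lower_bound:
  "(1 - l) * (norm (x k - p))\<^sup>2 + inner (y k - q) (M (y k - q)) \<le> energy p q k"
  using forward_difference_bound[of "x k" "x (k - 1)" "x k - p"]
  unfolding energy_def left_diff_distrib mult_1 by linarith

lemma one_minus_l_pos: "0 < 1 - l"
  using l_nonneg l_less \<mu>_le_1 by linarith

lemma energy_nonneg: "0 \<le> energy p q k"
proof -
  have "0 \<le> (1 - l) * (norm (x k - p))\<^sup>2 + inner (y k - q) (M (y k - q))"
    using one_minus_l_pos M_psd by simp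
  then show ?thesis
    using energy_lower_bound[of k p q] by linarith
qed

lemma energy_Suc_le:
  assumes "saddle_point p q"
  shows "energy p q (Suc k) \<le> energy p q k"
proof -
  have "0 \<le> (\<mu> - 2 * l) * (norm (x (Suc k) - x k))\<^sup>2 + inner (x k) (M (x k))"
    using l_less M_psd by simp
  then show ?thesis
    using energy_decrease[OF assms, of k] by linarith
qed

lemma energy_convergent:
  assumes "saddle_point p q"
  obtains L where "energy p q \<longlonglongrightarrow> L"
proof -
  have "decseq (energy p q)"
    using energy_Suc_le[OF assms] by (rule decseq_SucI)
  then show thesis
    using decseq_convergent[of "energy p q" 0] energy_nonneg that by metis
qed

text \<open>
  The decrease of a convergent energy tends to zero, and it dominates both residuals.
\<close>

lemma residuals_tendsto_0:
  assumes "saddle_point p q"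
  shows "(\<lambda>k. x (Suc k) - x k) \<longlonglongrightarrow> 0" and "(\<lambda>k. M (x k)) \<longlonglongrightarrow> 0"
proof -
  obtain L where L: "energy p q \<longlonglongrightarrow> L"
    using energy_convergent[OF assms] by blast
  define R where "R k = energy p q k - energy p q (Suc k)" for k
  have "R \<longlonglongrightarrow> L - L"
    unfolding R_def by (intro tendsto_diff L LIMSEQ_Suc)
  then have R: "R \<longlonglongrightarrow> 0"
    by simp
  have le1: "(\<mu> - 2 * l) * (norm (x (Suc k) - x k))\<^sup>2 \<le> R k" for k
    using energy_decrease[OF assms, of k] M_psd[of "x k"] unfolding R_def by linarith
  have le2: "(norm (M (x k)))\<^sup>2 \<le> R k" for k
  proof -
    have "0 \<le> (\<mu> - 2 * l) * (norm (x (Suc k) - x k))\<^sup>2"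
      using l_less by simp
    then show ?thesis
      using energy_decrease[OF assms, of k] norm_M_le[of "x k"] unfolding R_def by linarith
  qed
  have "(\<lambda>k. (norm (x (Suc k) - x k))\<^sup>2) \<longlonglongrightarrow> 0"
  proof (rule tendsto_sandwich[where f = "\<lambda>_. 0"])
    show "(\<lambda>k. R k / (\<mu> - 2 * l)) \<longlonglongrightarrow> 0"
      using tendsto_divide_zero[OF R] .
    show "\<forall>\<^sub>F k in sequentially. (norm (x (Suc k) - x k))\<^sup>2 \<le> R k / (\<mu> - 2 * l)"
      using le1 l_less by (simp add: pos_le_divide_eq mult.commute)
  qed auto
  then show "(\<lambda>k. x (Suc k) - x k) \<longlonglongrightarrow> 0"
    by (simp add: tendsto_norm_zero_iff)
  have "(\<lambda>k. (norm (M (x k)))\<^sup>2) \<longlonglongrightarrow> 0"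
    by (rule tendsto_sandwich[OF _ _ tendsto_const R]) (use le2 in simp_all)
  then show "(\<lambda>k. M (x k)) \<longlonglongrightarrow> 0"
    by (simp add: tendsto_norm_zero_iff)
qed

lemma x_bounded:
  assumes "saddle_point p q"
  obtains r where "\<And>k. norm (x k) \<le> r"
proof -
  have "norm (x k) \<le> norm p + sqrt (energy p q 0 / (1 - l))" for k
  proof -
    have "energy p q k \<le> energy p q 0"
      using energy_Suc_le[OF assms] by (rule lift_Suc_antimono_le) simp
    then have "(1 - l) * (norm (x k - p))\<^sup>2 \<le> energy p q 0"
      using energy_lower_bound[of k p q] M_psd[of "y k - q"] by linarith
    then have "(norm (x k - p))\<^sup>2 \<le> energy p q 0 / (1 - l)"
      using one_minus_l_pos by (simp add: pos_le_divide_eq mult.commute)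
    then have "norm (x k - p) \<le> sqrt (energy p q 0 / (1 - l))"
      by (rule real_le_rsqrt)
    then show ?thesis
      using norm_triangle_sub[of "x k" p] by linarith
  qed
  then show thesis by (rule that)
qed

text \<open>
  Boundedness can be expected only of the images under \<open>M\<close>: the parts of the \<open>x\<^sub>k\<close> in the kernel
  of \<open>M\<close> add up in \<open>y\<^sub>k\<close> without being seen by the energy.
\<close>

lemma M_y_bounded:
  assumes "saddle_point p q"
  obtains r where "\<And>k. norm (M (y k)) \<le> r"
proof -
  have "norm (M (y k)) \<le> norm (M q) + sqrt (energy p q 0)" for k
  proof -
    have "energy p q k \<le> energy p q 0"
      using energy_Suc_le[OF assms] by (rule lift_Suc_antimono_le) simp
    moreover have "0 \<le> (1 - l) * (norm (x k - p))\<^sup>2"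
      using one_minus_l_pos by simp
    ultimately have "(norm (M (y k - q)))\<^sup>2 \<le> energy p q 0"
      using energy_lower_bound[of k p q] norm_M_le[of "y k - q"] by linarith
    then have "norm (M (y k - q)) \<le> sqrt (energy p q 0)"
      by (rule real_le_rsqrt)
    then show ?thesis
      using norm_triangle_sub[of "M (y k)" "M q"] unfolding M.diff by linarith
  qed
  then show thesis by (rule that)
qed

text \<open>
  Opial's argument: cluster points are saddle points, and the energy with respect to a cluster point
  converges and tends to zero along a subsequence.
\<close>

theorem convergence:
  assumes "saddle_point p0 q0"
  obtains p q where "saddle_point p q" "x \<longlonglongrightarrow> p"
proof -
  obtain r1 where r1: "\<And>k. norm (x k) \<le> r1"
    using x_bounded[OF assms] by blast
  obtain p s1 where s1: "strict_mono (s1 :: nat \<Rightarrow> nat)" "(\<lambda>j. x (s1 j)) \<longlonglongrightarrow> p"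
    by (rule bounded_sequence_subsequence[OF finite_dim r1])
  obtain r2 where r2: "\<And>k. norm (M (y k)) \<le> r2"
    using M_y_bounded[OF assms] by blast
  obtain g s2 where s2: "strict_mono (s2 :: nat \<Rightarrow> nat)" "(\<lambda>j. M (y (s1 (s2 j)))) \<longlonglongrightarrow> g"
    by (rule bounded_sequence_subsequence[OF finite_dim r2, of "\<lambda>j. s1 j"])
  define s where "s = s1 \<circ> s2"
  have s: "strict_mono s"
    unfolding s_def using s1 s2 by (simp add: strict_mono_o)
  have sub: "(\<lambda>j. f (s j)) \<longlonglongrightarrow> c" if "f \<longlonglongrightarrow> c" for f :: "nat \<Rightarrow> 'b::topological_space" and c
    using LIMSEQ_subseq_LIMSEQ[OF that s] by (simp add: o_def)
  have xs: "(\<lambda>j. x (s j)) \<longlonglongrightarrow> p"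
    using LIMSEQ_subseq_LIMSEQ[OF s1(2) s2(1)] by (simp add: o_def s_def)
  have ys: "(\<lambda>j. M (y (s j))) \<longlonglongrightarrow> g"
    using s2 by (simp add: s_def)
  have d: "(\<lambda>k. x (Suc k) - x k) \<longlonglongrightarrow> 0" and Mx: "(\<lambda>k. M (x k)) \<longlonglongrightarrow> 0"
    using residuals_tendsto_0[OF assms] .
  have e: "(\<lambda>k. x k - x (k - 1)) \<longlonglongrightarrow> 0"
    by (rule LIMSEQ_imp_Suc) (use d in simp)
  have Fe: "(\<lambda>k. F (x k) - F (x (k - 1))) \<longlonglongrightarrow> 0"
  proof (rule Lim_null_comparison)
    show "\<forall>\<^sub>F k in sequentially. norm (F (x k) - F (x (k - 1))) \<le> l * norm (x k - x (k - 1))"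
      using F_lipschitz by simp
    show "(\<lambda>k. l * norm (x k - x (k - 1))) \<longlonglongrightarrow> 0"
      using e by (intro tendsto_mult_right_zero tendsto_norm_zero)
  qed
  have Fs: "(\<lambda>j. F (x (s j))) \<longlonglongrightarrow> F p"
  proof (rule LIM_zero_cancel, rule Lim_null_comparison)
    show "\<forall>\<^sub>F j in sequentially. norm (F (x (s j)) - F p) \<le> l * norm (x (s j) - p)"
      using F_lipschitz by simp
    show "(\<lambda>j. l * norm (x (s j) - p)) \<longlonglongrightarrow> 0"
      using xs by (intro tendsto_mult_right_zero tendsto_norm_zero LIM_zero)
  qed
  have Mp: "M p = 0"
    using LIMSEQ_unique[OF M.tendsto[OF xs] sub[OF Mx]] .
  have "(\<lambda>j. M (N (M (y (s j))))) \<longlonglongrightarrow> M (N g)"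
    by (intro M.tendsto N.tendsto ys)
  then have g: "M (N g) = g"
    using ys by (intro LIMSEQ_unique[of "\<lambda>j. M (y (s j))"]) (simp_all add: N_inverse)
  \<comment> \<open>The limit of the dual images lies in the range of \<open>M\<close>; any preimage serves as dual solution.\<close>
  define q where "q = N g"
  have xSuc: "(\<lambda>j. x (Suc (s j))) \<longlonglongrightarrow> p"
    using tendsto_add[OF xs sub[OF d]] by simp
  have "(\<lambda>j. - (x (Suc (s j)) - x (s j)) - (F (x (s j)) + (F (x (s j)) - F (x (s j - 1)))) - (M (y (s j)) + M (x (s j))))
      \<longlonglongrightarrow> - 0 - (F p + 0) - (g + 0)"
    by (intro tendsto_intros sub[OF d] Fs sub[OF Fe] ys sub[OF Mx])
  moreover have "- (x (Suc j) - x j) - (F (x j) + (F (x j) - F (x (j - 1)))) - (M (y j) + M (x j)) \<in> T (x (Suc j))" for j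
    using x_step[of j] by (simp add: M.add scaleR_2 algebra_simps)
  ultimately have "- 0 - (F p + 0) - (g + 0) \<in> T p"
    by (intro maximally_monotone_closed_graph[OF T_maximal xSuc])
  then have pq: "saddle_point p q"
    unfolding saddle_point_def q_def using Mp g by simp
  obtain L where L: "energy p q \<longlonglongrightarrow> L"
    using energy_convergent[OF pq] by blast
  have ysq: "(\<lambda>j. M (y (s j) - q)) \<longlonglongrightarrow> 0"
    using LIM_zero[OF ys] unfolding M.diff q_def g .
  \<comment> \<open>The dual part of the energy depends continuously on the image of the dual vector under \<open>M\<close>,
    although the dual sequence itself need not converge.\<close>
  have "inner (y j - q) (M (y j - q)) = inner (M (y j - q)) (N (M (y j - q)))" for j
    using N_inverse[of "y j - q"] M_symmetric by metis
  then have "energy p q (s j) = (norm (x (s j) - p))\<^sup>2 + inner (M (y (s j) - q)) (N (M (y (s j) - q)))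
     - 2 * inner (F (x (s j)) - F (x (s j - 1))) (x (s j) - p) + l * (norm (x (s j) - x (s j - 1)))\<^sup>2" for j
    unfolding energy_def by simp
  moreover have "(\<lambda>j. (norm (x (s j) - p))\<^sup>2 + inner (M (y (s j) - q)) (N (M (y (s j) - q)))
     - 2 * inner (F (x (s j)) - F (x (s j - 1))) (x (s j) - p) + l * (norm (x (s j) - x (s j - 1)))\<^sup>2)
     \<longlonglongrightarrow> (norm (p - p))\<^sup>2 + inner 0 (N 0) - 2 * inner 0 (p - p) + l * (norm (0 :: 'a))\<^sup>2"
    by (intro tendsto_intros N.tendsto xs ysq sub[OF Fe] sub[OF e])
  ultimately have "(\<lambda>j. energy p q (s j)) \<longlonglongrightarrow> 0"
    by simp
  then have E: "energy p q \<longlonglongrightarrow> 0"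
    using LIMSEQ_unique[OF sub[OF L]] L by blast
  have "(\<lambda>k. (norm (x k - p))\<^sup>2) \<longlonglongrightarrow> 0"
  proof (rule tendsto_sandwich[where f = "\<lambda>_. 0"])
    show "(\<lambda>k. energy p q k / (1 - l)) \<longlonglongrightarrow> 0"
      using tendsto_divide_zero[OF E] .
    have "(1 - l) * (norm (x k - p))\<^sup>2 \<le> energy p q k" for k
      using energy_lower_bound[of k p q] M_psd[of "y k - q"] by linarith
    then show "\<forall>\<^sub>F k in sequentially. (norm (x k - p))\<^sup>2 \<le> energy p q k / (1 - l)"
      using one_minus_l_pos by (simp add: pos_le_divide_eq mult.commute)
  qed auto
  then have "x \<longlonglongrightarrow> p"
    by (simp add: tendsto_norm_zero_iff LIM_zero_iff)
  then show thesis
    using pq that by blast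
qed

end

section \<open>Product maps and the consensus subspace\<close>

lemma monotone_prod_map:
  fixes B :: "'n::finite \<Rightarrow> 'a::real_inner \<Rightarrow> 'a"
  assumes "\<And>i. monotone_operator (\<lambda>z. {B i z})"
  shows "inner (a - b) (prod_map B a - prod_map B b) \<ge> 0"
proof -
  have "inner (a $ i - b $ i) (B i (a $ i) - B i (b $ i)) \<ge> 0" for i
    using assms[of i] unfolding monotone_operator_def by blast
  then show ?thesis
    unfolding inner_vec_def prod_map_def by (simp add: sum_nonneg)
qed

lemma prod_map_lipschitz:
  fixes B :: "'n::finite \<Rightarrow> 'a::real_inner \<Rightarrow> 'a"
  assumes "\<And>i. L-lipschitz_on UNIV (B i)"
  shows "norm (prod_map B a - prod_map B b) \<le> L * norm (a - b)"
proof -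
  have L: "0 \<le> L"
    using assms lipschitz_on_nonneg by blast
  have "norm (prod_map B a - prod_map B b) = L2_set (\<lambda>i. norm (B i (a $ i) - B i (b $ i))) UNIV"
    unfolding norm_vec_def prod_map_def by simp
  also have "\<dots> \<le> L2_set (\<lambda>i. L * norm (a $ i - b $ i)) UNIV"
    using lipschitz_onD[OF assms] by (intro L2_set_mono) (simp_all add: dist_norm)
  also have "\<dots> = L * norm (a - b)"
    unfolding norm_vec_def using L by (simp add: L2_set_right_distrib)
  finally show ?thesis .
qed

lemma is_solution_iff:
  "is_solution A B z \<longleftrightarrow> (\<exists>a. (\<forall>i. a i \<in> A i z) \<and> (\<Sum>i\<in>UNIV. a i + B i z) = 0)"
proof -
  have "is_solution A B z \<longleftrightarrow> (\<exists>s. (\<forall>i. s i \<in> A i z + {B i z}) \<and> (\<Sum>i\<in>UNIV. s i) = 0)"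
    unfolding is_solution_def by (auto simp: set_sum_alt)
  also have "\<dots> \<longleftrightarrow> (\<exists>a. (\<forall>i. a i \<in> A i z) \<and> (\<Sum>i\<in>UNIV. a i + B i z) = 0)"
  proof
    assume "\<exists>s. (\<forall>i. s i \<in> A i z + {B i z}) \<and> (\<Sum>i\<in>UNIV. s i) = 0"
    then obtain s where s: "\<And>i. s i \<in> A i z + {B i z}" "(\<Sum>i\<in>UNIV. s i) = 0"
      by blast
    have "s i - B i z \<in> A i z" for i
      using s(1)[of i] by (auto simp: set_plus_def)
    then show "\<exists>a. (\<forall>i. a i \<in> A i z) \<and> (\<Sum>i\<in>UNIV. a i + B i z) = 0"
      using s(2) by (intro exI[of _ "\<lambda>i. s i - B i z"]) simp
  next
    assume "\<exists>a. (\<forall>i. a i \<in> A i z) \<and> (\<Sum>i\<in>UNIV. a i + B i z) = 0"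
    then obtain a where a: "\<And>i. a i \<in> A i z" "(\<Sum>i\<in>UNIV. a i + B i z) = 0"
      by blast
    then show "\<exists>s. (\<forall>i. s i \<in> A i z + {B i z}) \<and> (\<Sum>i\<in>UNIV. s i) = 0"
      by (intro exI[of _ "\<lambda>i. a i + B i z"]) (auto intro: set_plus_intro)
  qed
  finally show ?thesis .
qed

definition half_laplacian :: "real ^ 'n ^ 'n \<Rightarrow> real ^ 'n ^ 'n" where
  "half_laplacian W = (1 / 2) *\<^sub>R (mat 1 - W)"

lemma mat_act_half_laplacian: "mat_act (half_laplacian W) a = (1 / 2) *\<^sub>R (a - mat_act W a)"
  unfolding half_laplacian_def by (simp add: mat_act_scaleR_matrix mat_act_minus_matrix mat_act_one)

lemma half_laplacian_properties:
  assumes "mixing_matrix E W"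
  shows transpose_mixing_matrix: "transpose W = W"
    and half_laplacian_psd: "\<And>c. inner c (half_laplacian W *v c) \<ge> 0"
    and half_laplacian_ker: "\<And>c. half_laplacian W *v c = 0 \<longleftrightarrow> (\<forall>i j. c $ i = c $ j)"
    and half_laplacian_row_sum: "\<And>i. (\<Sum>j\<in>UNIV. half_laplacian W $ i $ j) = 0"
    and half_laplacian_column_sum: "\<And>j. (\<Sum>i\<in>UNIV. half_laplacian W $ i $ j) = 0"
proof -
  show W: "transpose W = W"
    using assms unfolding mixing_matrix_def by simp
  have M: "half_laplacian W *v c = (1 / 2) *\<^sub>R ((mat 1 - W) *v c)" for c
    unfolding half_laplacian_def mat_act_real[symmetric] mat_act_scaleR_matrix ..
  show "inner c (half_laplacian W *v c) \<ge> 0" for c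
    using assms unfolding mixing_matrix_def M by simp
  have "{c. (mat 1 - W) *v c = 0} = {c. \<forall>i j. c $ i = c $ j}"
    using assms unfolding mixing_matrix_def by blast
  then show ker: "half_laplacian W *v c = 0 \<longleftrightarrow> (\<forall>i j. c $ i = c $ j)" for c
    unfolding M by (auto simp: set_eq_iff)
  show row: "(\<Sum>j\<in>UNIV. half_laplacian W $ i $ j) = 0" for i
  proof -
    have "half_laplacian W *v (\<chi> j. 1) = 0"
      by (simp add: ker)
    then have "(half_laplacian W *v (\<chi> j. 1)) $ i = 0"
      by simp
    then show ?thesis
      by (simp add: matrix_vector_mult_def)
  qed
  have "half_laplacian W $ i $ j = half_laplacian W $ j $ i" for i j
    using W by (simp add: half_laplacian_def mat_def) (metis transpose_def vec_lambda_beta)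
  then show "(\<Sum>i\<in>UNIV. half_laplacian W $ i $ j) = 0" for j
    using row[of j] by simp
qed

lemma mat_act_half_laplacian_const:
  assumes "mixing_matrix E W"
  shows "mat_act (half_laplacian W) (\<chi> i. z) = 0"
  using half_laplacian_row_sum[OF assms] unfolding mat_act_def
  by (simp add: vec_eq_iff scaleR_sum_left[symmetric])

lemma mat_act_half_laplacian_eq_0_imp_const:
  fixes p :: "'a::real_inner ^ 'n"
  assumes W: "mixing_matrix E W" and p: "mat_act (half_laplacian W) p = 0"
  shows "p $ i = p $ j"
proof -
  \<comment> \<open>Pairing with a fixed vector reduces the claim to the kernel of the real matrix; the
    difference of the two components is paired with itself.\<close>
  let ?h = "p $ i - p $ j"
  let ?c = "\<chi> k. inner (p $ k) ?h"
  have "(half_laplacian W *v ?c) $ k = inner (mat_act (half_laplacian W) p $ k) ?h" for k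
    by (simp add: matrix_vector_mult_def mat_act_def inner_sum_left)
  then have "half_laplacian W *v ?c = 0"
    by (simp add: vec_eq_iff p)
  then have "?c $ i = ?c $ j"
    using half_laplacian_ker[OF W] by blast
  then have "inner ?h ?h = 0"
    unfolding inner_diff_left[of "p $ i" "p $ j"] by simp
  then show ?thesis
    by simp
qed

text \<open>
  Constant vectors are fixed by \<open>W\<close>, so 1 is an eigenvalue.
\<close>

lemma lambda_min_mixing_le_1:
  assumes "mixing_matrix E W"
  shows "lambda_min W \<le> 1"
proof (rule lambda_min_le_eigenvalue[OF transpose_mixing_matrix[OF assms]])
  have "mat_act (half_laplacian W) (\<chi> i. (1 :: real)) = 0"
    by (rule mat_act_half_laplacian_const[OF assms])
  then have "mat_act W (\<chi> i. (1 :: real)) = (\<chi> i. 1)"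
    unfolding mat_act_half_laplacian by simp
  then show "W *v (\<chi> i. 1) = 1 *\<^sub>R (\<chi> i. 1)"
    by (simp add: mat_act_real)
  show "(\<chi> i. (1 :: real)) \<noteq> 0"
    by (simp add: vec_eq_iff)
qed

text \<open>
  The Rayleigh bound for \<open>W\<close>, carried over to the product space by applying
  \<open>mat_act_positive_semidefinite\<close> to \<open>W - lambda_min W *\<^sub>R mat 1\<close>.
\<close>

lemma inner_half_laplacian_le:
  fixes a :: "'a::real_inner ^ 'n"
  assumes fd: "\<exists>S :: 'a set. finite S \<and> span S = UNIV" and W: "transpose W = W"
  shows "inner a (mat_act (half_laplacian W) a) \<le> (1 - (1 + lambda_min W) / 2) * inner a a"
proof -
  define Q where "Q = W - lambda_min W *\<^sub>R mat 1"
  have Q: "mat_act Q b = mat_act W b - lambda_min W *\<^sub>R b" for b :: "'b::real_vector ^ 'n"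
    unfolding Q_def by (simp add: mat_act_minus_matrix mat_act_scaleR_matrix mat_act_one)
  have "inner a (mat_act Q a) \<ge> 0"
  proof (rule mat_act_positive_semidefinite[OF fd])
    show "inner c (Q *v c) \<ge> 0" for c
      using lambda_min_le_rayleigh[OF W, of c] unfolding mat_act_real[symmetric] Q by (simp add: inner_diff_right)
  qed
  then show ?thesis
    unfolding Q mat_act_half_laplacian by (simp add: inner_diff_right field_simps)
qed

text \<open>
  The components of \<open>- \<tau> (a\<^sub>i + B\<^sub>i z)\<close> sum to zero, so this vector is the image of a dual vector.
\<close>

lemma solution_imp_saddle_point:
  fixes A :: "'n::finite \<Rightarrow> 'a::real_inner \<Rightarrow> 'a set"
  assumes W: "mixing_matrix E W" and "\<tau> > 0" and z: "is_solution A B z"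
  shows "\<exists>q. - (\<tau> *\<^sub>R prod_map B (\<chi> i. z)) - mat_act (half_laplacian W) q
    \<in> scale_operator \<tau> (prod_operator A) (\<chi> i. z)"
proof -
  obtain a where a: "\<And>i. a i \<in> A i z" "(\<Sum>i\<in>UNIV. a i + B i z) = 0"
    using z unfolding is_solution_iff by blast
  obtain N where N: "\<And>g :: 'a ^ 'n. (\<Sum>i\<in>UNIV. g $ i) = 0 \<Longrightarrow>
      mat_act (half_laplacian W) (mat_act N g) = g"
    using mean_zero_right_inverse[OF half_laplacian_psd[OF W] _ half_laplacian_column_sum[OF W]]
      half_laplacian_ker[OF W] by metis
  define g :: "'a ^ 'n" where "g = (\<chi> i. - (\<tau> *\<^sub>R (a i + B i z)))"
  have "(\<Sum>i\<in>UNIV. g $ i) = - (\<tau> *\<^sub>R (\<Sum>i\<in>UNIV. a i + B i z))"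
    unfolding g_def by (simp only: vec_lambda_beta sum_negf scaleR_sum_right)
  then have "mat_act (half_laplacian W) (mat_act N g) = g"
    using a(2) by (intro N) simp
  moreover have "- (\<tau> *\<^sub>R prod_map B (\<chi> i. z)) - g = \<tau> *\<^sub>R (\<chi> i. a i)"
    by (simp add: vec_eq_iff g_def prod_map_def scaleR_add_right)
  moreover have "\<tau> *\<^sub>R (\<chi> i. a i) \<in> scale_operator \<tau> (prod_operator A) (\<chi> i. z)"
    unfolding scale_operator_def prod_operator_def using a(1) by auto
  ultimately show ?thesis by metis
qed

text \<open>
  Summing over the components eliminates the dual variable, since column sums of
  \<open>half_laplacian W\<close> vanish.
\<close>

lemma saddle_point_imp_solution:
  fixes A :: "'n::finite \<Rightarrow> 'a::real_inner \<Rightarrow> 'a set"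
  assumes W: "mixing_matrix E W" and "\<tau> > 0"
    and p: "mat_act (half_laplacian W) p = 0"
    and pq: "- (\<tau> *\<^sub>R prod_map B p) - mat_act (half_laplacian W) q \<in> scale_operator \<tau> (prod_operator A) p"
  shows "\<exists>z. is_solution A B z \<and> p = (\<chi> i. z)"
proof -
  obtain z where z: "\<And>i. p $ i = z"
    using mat_act_half_laplacian_eq_0_imp_const[OF W p] by blast
  define a where "a i = - B i z - (1 / \<tau>) *\<^sub>R mat_act (half_laplacian W) q $ i" for i
  have "(1 / \<tau>) *\<^sub>R (- (\<tau> *\<^sub>R prod_map B p) - mat_act (half_laplacian W) q) \<in> prod_operator A p"
    using pq \<open>\<tau> > 0\<close> by (simp add: mem_scale_operator_iff)
  then have "a i \<in> A i z" for i
    using \<open>\<tau> > 0\<close> by (simp add: prod_operator_def prod_map_def z a_def scaleR_diff_right)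
  moreover have "(\<Sum>i\<in>UNIV. a i + B i z) = - ((1 / \<tau>) *\<^sub>R (\<Sum>i\<in>UNIV. mat_act (half_laplacian W) q $ i))"
    unfolding a_def by (simp add: sum_negf scaleR_sum_right)
  moreover have "(\<Sum>i\<in>UNIV. mat_act (half_laplacian W) q $ i) = 0"
    by (rule sum_mat_act_eq_0[OF half_laplacian_column_sum[OF W]])
  ultimately have "is_solution A B z"
    unfolding is_solution_iff by (intro exI[of _ a]) simp
  moreover have "p = (\<chi> i. z)"
    by (simp add: vec_eq_iff z)
  ultimately show ?thesis by blast
qed

section \<open>Convergence of the decentralised algorithm\<close>

theorem corollary4p5:
  fixes A :: "'n::finite \<Rightarrow> 'h::real_inner \<Rightarrow> 'h set"
    and B :: "'n \<Rightarrow> 'h \<Rightarrow> 'h"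
    and E :: "('n \<times> 'n) set"
    and W :: "real ^ 'n ^ 'n"
    and L \<tau> :: real
    and x u v :: "nat \<Rightarrow> 'h ^ 'n"
  assumes finite_dim: "\<exists>S :: 'h set. finite S \<and> span S = UNIV"
    and L_pos: "L > 0"
    and A_maximal: "\<And>i. maximally_monotone (A i)"
    and B_monotone: "\<And>i. monotone_operator (\<lambda>y. {B i y})"
    and B_lipschitz: "\<And>i. L-lipschitz_on UNIV (B i)"
    and solvable: "\<exists>y. is_solution A B y"
    and graph: "connected_simple_graph E"
    and mixing: "mixing_matrix E W"
    and \<tau>_pos: "0 < \<tau>"
    and \<tau>_less: "\<tau> < (1 + lambda_min W) / (4 * L)"
    and v_0: "v 0 = prod_map B (x 0)"
    and u_1: "u 1 = x 0 - \<tau> *\<^sub>R v 0"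
    and x_1: "x 1 = resolvent (scale_operator \<tau> (prod_operator A)) (u 1)"
    and v_step: "\<And>k. k \<ge> 1 \<Longrightarrow>
      v k = 2 *\<^sub>R prod_map B (x k) - prod_map B (x (k - 1))"
    and u_step: "\<And>k. k \<ge> 1 \<Longrightarrow>
      u (k + 1) = mat_act W (x k) + u k - (1 / 2) *\<^sub>R mat_act (mat 1 + W) (x (k - 1))
        - \<tau> *\<^sub>R (v k - v (k - 1))"
    and x_step: "\<And>k. k \<ge> 1 \<Longrightarrow>
      x (k + 1) = resolvent (scale_operator \<tau> (prod_operator A)) (u (k + 1))"
  shows "\<exists>y. is_solution A B y \<and> x \<longlonglongrightarrow> (\<chi> i. y)"
proof -
  define M :: "'h ^ 'n \<Rightarrow> 'h ^ 'n" where "M = mat_act (half_laplacian W)"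
  define F where "F a = \<tau> *\<^sub>R prod_map B a" for a
  define T where "T = scale_operator \<tau> (prod_operator A)"
  \<comment> \<open>The start \<open>- x 0\<close> cancels \<open>x 0\<close> in the dual term, matching \<open>u 1 = x 0 - \<tau> v 0\<close>.\<close>
  define y where "y = rec_nat (- x 0) (\<lambda>k z. z + x (Suc k))"
  have symW: "transpose W = W"
    by (rule transpose_mixing_matrix[OF mixing])
  have fd: "\<exists>S :: ('h ^ 'n) set. finite S \<and> span S = UNIV"
    by (rule finite_dimensional_vec[OF finite_dim])
  have T_max: "maximally_monotone T"
    unfolding T_def
    by (intro maximally_monotone_scale_operator maximally_monotone_prod_operator finite_dim A_maximal \<tau>_pos)
  obtain N where N: "\<And>g :: 'h ^ 'n. (\<Sum>i\<in>UNIV. g $ i) = 0 \<Longrightarrow> M (mat_act N g) = g"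
    using mean_zero_right_inverse[OF half_laplacian_psd[OF mixing] _ half_laplacian_column_sum[OF mixing]]
      half_laplacian_ker[OF mixing] unfolding M_def by metis
  have W_eq: "mat_act W a = a - 2 *\<^sub>R M a" for a :: "'h ^ 'n"
    unfolding M_def mat_act_half_laplacian by simp
  have M_add: "M (a + b) = M a + M b" for a b
    unfolding M_def using linear_add[OF linear_mat_act] .
  have y0: "y 0 = - x 0" and y_Suc: "y (Suc k) = y k + x (Suc k)" for k
    unfolding y_def by simp_all
  have v: "v k = 2 *\<^sub>R prod_map B (x k) - prod_map B (x (k - 1))" for k
    using v_0 v_step[of k] by (cases k) (simp_all add: scaleR_2)
  \<comment> \<open>Telescoping turns the memory in the recursion for \<open>u\<close> into the dual sequence.\<close>
  have u: "u (Suc k) = x k - \<tau> *\<^sub>R v k - M (y k + x k)" for k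
  proof (induction k)
    case 0
    have "M 0 = 0"
      unfolding M_def by (rule linear_0[OF linear_mat_act])
    then show ?case
      using u_1 y0 by simp
  next
    case (Suc k)
    have "(1 / 2) *\<^sub>R mat_act (mat 1 + W) (x k) = x k - M (x k)"
      by (simp add: mat_act_plus_matrix mat_act_one W_eq scaleR_add_right scaleR_diff_right flip: scaleR_add_left)
    then have "u (Suc (Suc k)) = (x (Suc k) - 2 *\<^sub>R M (x (Suc k))) + u (Suc k) - (x k - M (x k))
        - \<tau> *\<^sub>R (v (Suc k) - v k)"
      using u_step[of "Suc k"] by (simp add: W_eq)
    then show ?case
      unfolding Suc.IH y_Suc by (simp add: M_add scaleR_2 algebra_simps)
  qed
  have x_Suc: "x (Suc k) = resolvent T (u (Suc k))" for k
    using x_1 x_step[of k] unfolding T_def by (cases k) simp_all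
  interpret primal_dual_iteration T F M "mat_act N" "\<tau> * L" "(1 + lambda_min W) / 2" x y
  proof (rule primal_dual_iteration.intro)
    show "\<exists>S :: ('h ^ 'n) set. finite S \<and> span S = UNIV" by (rule fd)
    show "maximally_monotone T" by (rule T_max)
    show "inner (a - b) (F a - F b) \<ge> 0" for a b
      unfolding F_def using monotone_prod_map[OF B_monotone, of a b] \<tau>_pos
      by (simp flip: scaleR_diff_right)
    show "norm (F a - F b) \<le> \<tau> * L * norm (a - b)" for a b
      unfolding F_def using prod_map_lipschitz[where B = B, OF B_lipschitz, of a b] \<tau>_pos
      by (simp add: mult.assoc flip: scaleR_diff_right)
    show "bounded_linear M" "bounded_linear (mat_act N :: 'h ^ 'n \<Rightarrow> 'h ^ 'n)"
      unfolding M_def by (rule bounded_linear_mat_act)+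
    show "inner (M a) b = inner a (M b)" for a b
      unfolding M_def mat_act_half_laplacian
      by (simp add: inner_diff_left inner_diff_right inner_mat_act_symmetric[OF symW])
    show "inner a (M a) \<ge> 0" for a
      unfolding M_def by (rule mat_act_positive_semidefinite[OF finite_dim half_laplacian_psd[OF mixing]])
    show "inner a (M a) \<le> (1 - (1 + lambda_min W) / 2) * inner a a" for a
      unfolding M_def by (rule inner_half_laplacian_le[OF finite_dim symW])
    show "M (mat_act N (M a)) = M a" for a
      unfolding M_def by (rule N[unfolded M_def]) (rule sum_mat_act_eq_0[OF half_laplacian_column_sum[OF mixing]])
    show "0 \<le> \<tau> * L"
      using \<tau>_pos L_pos by simp
    show "2 * (\<tau> * L) < (1 + lambda_min W) / 2"
      using \<tau>_less L_pos by (simp add: field_simps)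
    show "(1 + lambda_min W) / 2 \<le> 1"
      using lambda_min_mixing_le_1[OF mixing] by simp
    show "y (Suc k) = y k + x (Suc k)" for k
      by (rule y_Suc)
    show "x k - x (Suc k) - (2 *\<^sub>R F (x k) - F (x (k - 1))) - M (y k + x k) \<in> T (x (Suc k))" for k
    proof -
      have *: "x k - x (Suc k) - (2 *\<^sub>R F (x k) - F (x (k - 1))) - M (y k + x k) = u (Suc k) - x (Suc k)"
        unfolding u v F_def by (simp add: scaleR_diff_right)
      show ?thesis
        using resolvent_mem[OF fd T_max, of "u (Suc k)"] unfolding * x_Suc[symmetric] .
    qed
  qed
  obtain z where z: "is_solution A B z"
    using solvable by blast
  have "M (\<chi> i. z) = 0"
    unfolding M_def by (rule mat_act_half_laplacian_const[OF mixing])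
  moreover obtain q0 where "- F (\<chi> i. z) - M q0 \<in> T (\<chi> i. z)"
    using solution_imp_saddle_point[OF mixing \<tau>_pos z] unfolding F_def M_def T_def by blast
  ultimately have "saddle_point (\<chi> i. z) q0"
    unfolding saddle_point_def by blast
  then obtain p q where pq: "saddle_point p q" and "x \<longlonglongrightarrow> p"
    by (rule convergence)
  have "M p = 0" and "- F p - M q \<in> T p"
    using pq by (simp_all add: saddle_point_def)
  then have "\<exists>z. is_solution A B z \<and> p = (\<chi> i. z)"
    unfolding F_def M_def T_def by (rule saddle_point_imp_solution[OF mixing \<tau>_pos])
  then show ?thesis
    using \<open>x \<longlonglongrightarrow> p\<close> by blast
qed

end
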